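(* Let $E$ be a graph that satisfies Condition (L), let $K$ be a field, and let $L_K(E)$ be the associated Leavitt path algebra. If $A$ is a ring and $\pi:L_K(E)\to A$ is a ring homomorphism with $\pi(v)\neq0$ for all $v\in E^0$, then $\pi$ is injective.
   Context: Rings and algebras are not assumed commutative or unital. A graph $E=(E^0,E^1,r,s)$ is a directed graph with countable vertex set $E^0$, countable edge set $E^1$, and range and source maps $r,s:E^1\to E^0$ (no row-finiteness is assumed). A vertex $v$ is regular ($v\in E^0_{\mathrm{reg}}$) if $0<|s^{-1}(v)|<\infty$. The Leavitt path algebra $L_K(E)$ is the universal $K$-algebra generated by a set $\{v:v\in E^0\}$ of pairwise orthogonal idempotents together with elements $\{e,e^*:e\in E^1\}$ satisfying (1) $s(e)e=er(e)=e$; (2) $r(e)e^*=e^*s(e)=e^*$; (3) $e^*f=\delta_{e,f}r(e)$ for all $e,f\in E^1$; (4) $v=\sum_{s(e)=v}ee^*$ for all $v\in E^0_{\mathrm{reg}}$. A closed path is a path $\alpha=e_1\cdots e_n$ ($n\ge1$, $e_i\in E^1$, $r(e_i)=s(e_{i+1})$) with $r(e_n)=s(e_1)$. An edge $f\in E^1$ is an exit for $\alpha$ if for some $i\in\{1,\dots,n\}$ one has $s(f)=s(e_i)$ but $f\neq e_i$. $E$ satisfies Condition (L) if every closed path in $E$ has an exit. *)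

theory Defs
  imports
    "HOL-Library.Countable_Set"
    "HOL-Library.Poly_Mapping"
    "HOL-Algebra.QuotRing"
    "HOL-Algebra.Module"
    "Graph_Theory.Arc_Walk"
begin

section \<open>Rings without unit\<close>

text \<open>
  The records of HOL-Algebra are reused; the axioms and homomorphisms below ignore
  the field \<open>one\<close>, so nothing is assumed about a unit.
\<close>

locale nonunital_ring = abelian_group R for R (structure) +
  assumes m_closed: "\<lbrakk>x \<in> carrier R; y \<in> carrier R\<rbrakk> \<Longrightarrow> x \<otimes> y \<in> carrier R"
    and m_assoc: "\<lbrakk>x \<in> carrier R; y \<in> carrier R; z \<in> carrier R\<rbrakk>
      \<Longrightarrow> (x \<otimes> y) \<otimes> z = x \<otimes> (y \<otimes> z)"
    and l_distr: "\<lbrakk>x \<in> carrier R; y \<in> carrier R; z \<in> carrier R\<rbrakk>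
      \<Longrightarrow> (x \<oplus> y) \<otimes> z = x \<otimes> z \<oplus> y \<otimes> z"
    and r_distr: "\<lbrakk>x \<in> carrier R; y \<in> carrier R; z \<in> carrier R\<rbrakk>
      \<Longrightarrow> z \<otimes> (x \<oplus> y) = z \<otimes> x \<oplus> z \<otimes> y"

definition nonunital_ring_hom ::
  "('a, 'm) ring_scheme \<Rightarrow> ('b, 'n) ring_scheme \<Rightarrow> ('a \<Rightarrow> 'b) set" where
  "nonunital_ring_hom R S = {h \<in> carrier R \<rightarrow> carrier S.
     \<forall>x\<in>carrier R. \<forall>y\<in>carrier R.
       h (x \<oplus>\<^bsub>R\<^esub> y) = h x \<oplus>\<^bsub>S\<^esub> h y \<and> h (x \<otimes>\<^bsub>R\<^esub> y) = h x \<otimes>\<^bsub>S\<^esub> h y}"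


section \<open>Graphs\<close>

text \<open>
  A graph is a \<open>wf_digraph\<close>: multiple arcs and loops are allowed, the
  source map is \<open>tail\<close> and the range map is \<open>head\<close>.
  A closed path is a \<open>closed_w\<close>, a nonempty walk that ends where it starts.
\<close>

definition regular_vertex :: "('v, 'e) pre_digraph \<Rightarrow> 'v \<Rightarrow> bool" where
  "regular_vertex E v \<longleftrightarrow> v \<in> verts E \<and> out_arcs E v \<noteq> {} \<and> finite (out_arcs E v)"

definition exit_of :: "('v, 'e) pre_digraph \<Rightarrow> 'e \<Rightarrow> 'e list \<Rightarrow> bool" where
  "exit_of E f p \<longleftrightarrow>
     f \<in> arcs E \<and> (\<exists>i<length p. tail E f = tail E (p ! i) \<and> f \<noteq> p ! i)"

definition condition_L :: "('v, 'e) pre_digraph \<Rightarrow> bool" where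
  "condition_L E \<longleftrightarrow> (\<forall>p. wf_digraph.closed_w E p \<longrightarrow> (\<exists>f. exit_of E f p))"


section \<open>The free algebra on the vertices, edges and ghost edges\<close>

datatype 'x word = Word (letters: "'x list")

instantiation word :: (type) monoid_add
begin

definition "0 = Word []"
definition "u + w = Word (letters u @ letters w)"

instance
  by standard (simp_all add: zero_word_def plus_word_def)

end

datatype ('v, 'e) generator = Vertex 'v | Edge 'e | Ghost 'e

type_synonym ('v, 'e, 'k) ncpoly = "('v, 'e) generator word \<Rightarrow>\<^sub>0 'k"

definition vtx :: "'v \<Rightarrow> ('v, 'e, 'k::field) ncpoly" where
  "vtx v = Poly_Mapping.single (Word [Vertex v]) 1"

definition edge :: "'e \<Rightarrow> ('v, 'e, 'k::field) ncpoly" where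
  "edge e = Poly_Mapping.single (Word [Edge e]) 1"

definition ghost :: "'e \<Rightarrow> ('v, 'e, 'k::field) ncpoly" where
  "ghost e = Poly_Mapping.single (Word [Ghost e]) 1"

text \<open>\<open>single 0 c\<close> is the constant polynomial with value \<open>c\<close>.\<close>

definition scale :: "'k::field \<Rightarrow> ('v, 'e, 'k) ncpoly \<Rightarrow> ('v, 'e, 'k) ncpoly" where
  "scale c f = Poly_Mapping.single 0 c * f"

definition generators :: "('v, 'e) pre_digraph \<Rightarrow> ('v, 'e) generator set" where
  "generators E = Vertex ` verts E \<union> Edge ` arcs E \<union> Ghost ` arcs E"

text \<open>
  The free algebra is the non-unital one: the empty word is excluded, so the
  constant polynomial \<open>1\<close> filling the field \<open>one\<close> is not in the carrier.
\<close>

definition free_algebra ::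
  "('v, 'e) pre_digraph \<Rightarrow> ('k::field, ('v, 'e, 'k) ncpoly) module" where
  "free_algebra E =
     \<lparr>carrier = {f. \<forall>w\<in>Poly_Mapping.keys f. letters w \<noteq> [] \<and> set (letters w) \<subseteq> generators E},
      mult = (*), one = 1, zero = 0, add = (+), smult = scale\<rparr>"


section \<open>The Leavitt path algebra\<close>

definition leavitt_relators :: "('v, 'e) pre_digraph \<Rightarrow> ('v, 'e, 'k::field) ncpoly set" where
  "leavitt_relators E =
     {vtx v * vtx w - (if v = w then vtx v else 0) | v w. v \<in> verts E \<and> w \<in> verts E}
   \<union> {vtx (tail E e) * edge e - edge e | e. e \<in> arcs E}
   \<union> {edge e * vtx (head E e) - edge e | e. e \<in> arcs E}
   \<union> {vtx (head E e) * ghost e - ghost e | e. e \<in> arcs E}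
   \<union> {ghost e * vtx (tail E e) - ghost e | e. e \<in> arcs E}
   \<union> {ghost e * edge f - (if e = f then vtx (head E e) else 0) | e f. e \<in> arcs E \<and> f \<in> arcs E}
   \<union> {vtx v - (\<Sum>e\<in>out_arcs E v. edge e * ghost e) | v. regular_vertex E v}"

text \<open>The two-sided algebra ideal generated by the relators.\<close>

inductive_set leavitt_ideal ::
  "('v, 'e) pre_digraph \<Rightarrow> ('v, 'e, 'k::field) ncpoly set" for E where
  relator: "x \<in> leavitt_relators E \<Longrightarrow> x \<in> leavitt_ideal E"
| zero: "0 \<in> leavitt_ideal E"
| add: "\<lbrakk>x \<in> leavitt_ideal E; y \<in> leavitt_ideal E\<rbrakk> \<Longrightarrow> x + y \<in> leavitt_ideal E"
| scale: "x \<in> leavitt_ideal E \<Longrightarrow> scale c x \<in> leavitt_ideal E"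
| mult_left: "\<lbrakk>a \<in> carrier (free_algebra E); x \<in> leavitt_ideal E\<rbrakk> \<Longrightarrow> a * x \<in> leavitt_ideal E"
| mult_right: "\<lbrakk>x \<in> leavitt_ideal E; a \<in> carrier (free_algebra E)\<rbrakk> \<Longrightarrow> x * a \<in> leavitt_ideal E"

definition leavitt_path_algebra ::
  "('v, 'e) pre_digraph \<Rightarrow> ('k::field, ('v, 'e, 'k) ncpoly set) module" where
  "leavitt_path_algebra E =
     ring.extend (free_algebra E Quot leavitt_ideal E)
       (module.fields (\<lambda>c X. \<Union>x\<in>X. leavitt_ideal E +>\<^bsub>free_algebra E\<^esub> (c \<odot>\<^bsub>free_algebra E\<^esub> x)))"

definition lpa_vertex :: "('v, 'e) pre_digraph \<Rightarrow> 'v \<Rightarrow> ('v, 'e, 'k::field) ncpoly set" where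
  "lpa_vertex E v = leavitt_ideal E +>\<^bsub>free_algebra E\<^esub> vtx v"


section \<open>The Leavitt path algebra is a ring\<close>

lemma free_algebra_simps [simp]:
  "mult (free_algebra E) = (*)" "one (free_algebra E) = 1" "zero (free_algebra E) = 0"
  "add (free_algebra E) = (+)" "smult (free_algebra E) = scale"
  by (simp_all add: free_algebra_def)

lemma leavitt_path_algebra_simps:
  "carrier (leavitt_path_algebra E) = a_rcosets\<^bsub>free_algebra E\<^esub> (leavitt_ideal E)"
  "mult (leavitt_path_algebra E) = rcoset_mult (free_algebra E) (leavitt_ideal E)"
  "add (leavitt_path_algebra E) = set_add (free_algebra E)"
  "zero (leavitt_path_algebra E) = leavitt_ideal E"
  "smult (leavitt_path_algebra E) =
     (\<lambda>c X. \<Union>x\<in>X. leavitt_ideal E +>\<^bsub>free_algebra E\<^esub> (scale c x))"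
  by (simp_all add: leavitt_path_algebra_def FactRing_def ring.defs module.defs)

lemma free_algebra_closed:
  "0 \<in> carrier (free_algebra E)"
  "\<lbrakk>f \<in> carrier (free_algebra E); g \<in> carrier (free_algebra E)\<rbrakk> \<Longrightarrow> f + g \<in> carrier (free_algebra E)"
  "f \<in> carrier (free_algebra E) \<Longrightarrow> - f \<in> carrier (free_algebra E)"
  "\<lbrakk>f \<in> carrier (free_algebra E); g \<in> carrier (free_algebra E)\<rbrakk> \<Longrightarrow> f - g \<in> carrier (free_algebra E)"
  "\<lbrakk>f \<in> carrier (free_algebra E); g \<in> carrier (free_algebra E)\<rbrakk> \<Longrightarrow> f * g \<in> carrier (free_algebra E)"
  "f \<in> carrier (free_algebra E) \<Longrightarrow> scale c f \<in> carrier (free_algebra E)"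
proof -
  show "0 \<in> carrier (free_algebra E)"
    by (simp add: free_algebra_def)
  show add: "f + g \<in> carrier (free_algebra E)"
    if "f \<in> carrier (free_algebra E)" "g \<in> carrier (free_algebra E)" for f g
    using that Poly_Mapping.keys_add[of f g] by (auto simp: free_algebra_def)
  show uminus: "- f \<in> carrier (free_algebra E)" if "f \<in> carrier (free_algebra E)" for f
    using that by (simp add: free_algebra_def)
  show "f - g \<in> carrier (free_algebra E)"
    if "f \<in> carrier (free_algebra E)" "g \<in> carrier (free_algebra E)"
    using add[OF that(1) uminus[OF that(2)]] by simp
  show "f * g \<in> carrier (free_algebra E)"
    if "f \<in> carrier (free_algebra E)" "g \<in> carrier (free_algebra E)"
    using that keys_mult[of f g] by (fastforce simp: free_algebra_def plus_word_def)
  show "scale c f \<in> carrier (free_algebra E)" if "f \<in> carrier (free_algebra E)"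
  proof -
    have "Poly_Mapping.keys (scale c f) \<subseteq> Poly_Mapping.keys f"
      using keys_mult[of "Poly_Mapping.single 0 c" f]
      by (auto simp: scale_def split: if_splits)
    then show ?thesis
      using that by (auto simp: free_algebra_def)
  qed
qed

lemma generators_closed:
  "v \<in> verts E \<Longrightarrow> vtx v \<in> carrier (free_algebra E)"
  "e \<in> arcs E \<Longrightarrow> edge e \<in> carrier (free_algebra E)"
  "e \<in> arcs E \<Longrightarrow> ghost e \<in> carrier (free_algebra E)"
  by (auto simp: vtx_def edge_def ghost_def free_algebra_def generators_def)

lemma abelian_group_free_algebra: "abelian_group (free_algebra E)"
proof (rule abelian_groupI)
  show "\<exists>g\<in>carrier (free_algebra E). g \<oplus>\<^bsub>free_algebra E\<^esub> f = \<zero>\<^bsub>free_algebra E\<^esub>"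
    if "f \<in> carrier (free_algebra E)" for f
    using that free_algebra_closed(3) by (intro bexI[of _ "- f"]) auto
qed (auto simp: free_algebra_closed ac_simps)

lemma nonunital_ring_free_algebra: "nonunital_ring (free_algebra E)"
  by (intro nonunital_ring.intro abelian_group_free_algebra nonunital_ring_axioms.intro)
    (auto simp: free_algebra_closed algebra_simps)

context
  fixes E :: "('v, 'e) pre_digraph"
  assumes E: "wf_digraph E"
begin

lemma leavitt_relators_closed: "leavitt_relators E \<subseteq> carrier (free_algebra E)"
proof -
  interpret wf_digraph E by (rule E)
  have sum: "(\<Sum>e\<in>A. edge e * ghost e) \<in> carrier (free_algebra E)"
    if "finite A" "A \<subseteq> arcs E" for A
    using that by (induction rule: finite_induct)
      (auto intro!: free_algebra_closed generators_closed)
  show ?thesis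
    unfolding leavitt_relators_def regular_vertex_def
    by (auto intro!: free_algebra_closed generators_closed sum split: if_splits)
qed

lemma leavitt_ideal_closed: "x \<in> leavitt_ideal E \<Longrightarrow> x \<in> carrier (free_algebra E)"
  by (induction rule: leavitt_ideal.induct)
    (use leavitt_relators_closed in \<open>auto simp: free_algebra_closed\<close>)

lemma leavitt_ideal_uminus: "x \<in> leavitt_ideal E \<Longrightarrow> - x \<in> leavitt_ideal E"
  using leavitt_ideal.scale[of x E "- 1"]
  by (simp add: scale_def single_uminus)

lemma leavitt_ideal_coset:
  "leavitt_ideal E +>\<^bsub>free_algebra E\<^esub> f = {g. g - f \<in> leavitt_ideal E}"
  by (force simp: a_r_coset_def r_coset_def)

lemma leavitt_ideal_coset_eq_iff:
  "leavitt_ideal E +>\<^bsub>free_algebra E\<^esub> f = leavitt_ideal E +>\<^bsub>free_algebra E\<^esub> g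
     \<longleftrightarrow> f - g \<in> leavitt_ideal E"
proof
  assume fg: "f - g \<in> leavitt_ideal E"
  have "h - g \<in> leavitt_ideal E" if "h - f \<in> leavitt_ideal E" for h
    using leavitt_ideal.add[OF that fg] by simp
  moreover have "h - f \<in> leavitt_ideal E" if "h - g \<in> leavitt_ideal E" for h
    using leavitt_ideal.add[OF that leavitt_ideal_uminus[OF fg]] by simp
  ultimately show "leavitt_ideal E +>\<^bsub>free_algebra E\<^esub> f = leavitt_ideal E +>\<^bsub>free_algebra E\<^esub> g"
    unfolding leavitt_ideal_coset by blast
next
  assume eq: "leavitt_ideal E +>\<^bsub>free_algebra E\<^esub> f = leavitt_ideal E +>\<^bsub>free_algebra E\<^esub> g"
  have "f \<in> leavitt_ideal E +>\<^bsub>free_algebra E\<^esub> f"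
    by (simp add: leavitt_ideal_coset leavitt_ideal.zero)
  then show "f - g \<in> leavitt_ideal E"
    unfolding eq by (simp add: leavitt_ideal_coset)
qed

lemma abelian_subgroup_leavitt_ideal:
  "abelian_subgroup (leavitt_ideal E :: ('v, 'e, 'k::field) ncpoly set) (free_algebra E)"
proof (rule abelian_subgroupI3)
  show "abelian_group (free_algebra E :: ('k, ('v, 'e, 'k) ncpoly) module)"
    by (rule abelian_group_free_algebra)
  interpret F: abelian_group "free_algebra E :: ('k, ('v, 'e, 'k) ncpoly) module"
    by (rule abelian_group_free_algebra)
  have inv: "inv\<^bsub>add_monoid (free_algebra E)\<^esub> x = - x"
    if "x \<in> leavitt_ideal E" for x :: "('v, 'e, 'k) ncpoly"
    by (rule group.inv_equality[OF F.a_group])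
      (simp_all add: that leavitt_ideal_closed free_algebra_closed)
  show "additive_subgroup (leavitt_ideal E :: ('v, 'e, 'k) ncpoly set) (free_algebra E)"
  proof (intro additive_subgroup.intro group.subgroupI[OF F.a_group])
    fix x y :: "('v, 'e, 'k) ncpoly"
    assume x: "x \<in> leavitt_ideal E"
    then show "inv\<^bsub>add_monoid (free_algebra E)\<^esub> x \<in> leavitt_ideal E"
      by (simp only: inv leavitt_ideal_uminus)
    assume "y \<in> leavitt_ideal E"
    with x show "x \<otimes>\<^bsub>add_monoid (free_algebra E)\<^esub> y \<in> leavitt_ideal E"
      by (simp add: leavitt_ideal.add)
  qed (auto intro: leavitt_ideal.zero simp: leavitt_ideal_closed)
qed

lemma leavitt_coset_mult:
  assumes "f \<in> carrier (free_algebra E)" "g \<in> carrier (free_algebra E)"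
  shows "rcoset_mult (free_algebra E) (leavitt_ideal E)
      (leavitt_ideal E +>\<^bsub>free_algebra E\<^esub> f) (leavitt_ideal E +>\<^bsub>free_algebra E\<^esub> g)
    = leavitt_ideal E +>\<^bsub>free_algebra E\<^esub> (f * g)"
proof -
  have eq: "leavitt_ideal E +>\<^bsub>free_algebra E\<^esub> (f' * g') = leavitt_ideal E +>\<^bsub>free_algebra E\<^esub> (f * g)"
    if "f' - f \<in> leavitt_ideal E" "g' - g \<in> leavitt_ideal E" for f' g'
  proof -
    have "f' = (f' - f) + f" by simp
    then have "f' \<in> carrier (free_algebra E)"
      using that(1) assms(1) leavitt_ideal_closed free_algebra_closed(2) by metis
    then have "f' * (g' - g) + (f' - f) * g \<in> leavitt_ideal E"
      using that assms by (intro leavitt_ideal.add leavitt_ideal.mult_left leavitt_ideal.mult_right)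
    then show ?thesis
      by (simp add: leavitt_ideal_coset_eq_iff algebra_simps)
  qed
  have "f \<in> leavitt_ideal E +>\<^bsub>free_algebra E\<^esub> f" "g \<in> leavitt_ideal E +>\<^bsub>free_algebra E\<^esub> g"
    by (simp_all add: leavitt_ideal_coset leavitt_ideal.zero)
  moreover have "leavitt_ideal E +>\<^bsub>free_algebra E\<^esub> (f' \<otimes>\<^bsub>free_algebra E\<^esub> g')
      = leavitt_ideal E +>\<^bsub>free_algebra E\<^esub> (f * g)"
    if "f' \<in> leavitt_ideal E +>\<^bsub>free_algebra E\<^esub> f" "g' \<in> leavitt_ideal E +>\<^bsub>free_algebra E\<^esub> g" for f' g'
    using eq[of f' g'] that by (simp add: leavitt_ideal_coset)
  ultimately show ?thesis
    unfolding rcoset_mult_def by blast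
qed

lemma leavitt_coset_add:
  assumes "f \<in> carrier (free_algebra E)" "g \<in> carrier (free_algebra E)"
  shows "set_add (free_algebra E)
      (leavitt_ideal E +>\<^bsub>free_algebra E\<^esub> f) (leavitt_ideal E +>\<^bsub>free_algebra E\<^esub> g)
    = leavitt_ideal E +>\<^bsub>free_algebra E\<^esub> (f + g)"
  using abelian_subgroup.a_rcos_sum[OF abelian_subgroup_leavitt_ideal assms] by simp

lemma leavitt_path_algebra_carrier:
  "carrier (leavitt_path_algebra E) =
     (\<lambda>f. leavitt_ideal E +>\<^bsub>free_algebra E\<^esub> f) ` carrier (free_algebra E)"
  by (auto simp: leavitt_path_algebra_simps A_RCOSETS_def')

lemma leavitt_path_algebra_nonunital_ring: "nonunital_ring (leavitt_path_algebra E)"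
proof -
  have zero: "leavitt_ideal E = leavitt_ideal E +>\<^bsub>free_algebra E\<^esub> 0"
    by (simp add: leavitt_ideal_coset)
  have "abelian_group (leavitt_path_algebra E)"
  proof (rule abelian_groupI; unfold leavitt_path_algebra_carrier; (elim imageE; hypsubst)?)
    fix f
    assume "f \<in> carrier (free_algebra E)"
    then show "\<exists>Y\<in>(\<lambda>f. leavitt_ideal E +>\<^bsub>free_algebra E\<^esub> f) ` carrier (free_algebra E).
        Y \<oplus>\<^bsub>leavitt_path_algebra E\<^esub> (leavitt_ideal E +>\<^bsub>free_algebra E\<^esub> f)
          = \<zero>\<^bsub>leavitt_path_algebra E\<^esub>"
      by (intro bexI[of _ "leavitt_ideal E +>\<^bsub>free_algebra E\<^esub> - f"])
        (simp_all add: leavitt_path_algebra_simps(3,4) leavitt_coset_add free_algebra_closed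
          flip: zero)
  next
    show "\<zero>\<^bsub>leavitt_path_algebra E\<^esub>
        \<in> (\<lambda>f. leavitt_ideal E +>\<^bsub>free_algebra E\<^esub> f) ` carrier (free_algebra E)"
      using zero free_algebra_closed(1) unfolding leavitt_path_algebra_simps(4) by blast
  next
    fix f
    assume "f \<in> carrier (free_algebra E)"
    then show "\<zero>\<^bsub>leavitt_path_algebra E\<^esub> \<oplus>\<^bsub>leavitt_path_algebra E\<^esub>
        (leavitt_ideal E +>\<^bsub>free_algebra E\<^esub> f) = leavitt_ideal E +>\<^bsub>free_algebra E\<^esub> f"
      using leavitt_coset_add[OF free_algebra_closed(1), of f]
      by (simp add: leavitt_path_algebra_simps(3,4) flip: zero)
  qed (simp_all add: leavitt_path_algebra_simps(3) leavitt_coset_add free_algebra_closed ac_simps)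
  moreover have "nonunital_ring_axioms (leavitt_path_algebra E)"
    by (rule nonunital_ring_axioms.intro; unfold leavitt_path_algebra_carrier; elim imageE; hypsubst)
      (simp_all add: leavitt_path_algebra_simps(2,3) leavitt_coset_mult leavitt_coset_add
        free_algebra_closed distrib_left distrib_right mult.assoc)
  ultimately show ?thesis
    by (rule nonunital_ring.intro)
qed

end

end

theory Submission
  imports Defs
begin

text \<open>
  Let \<open>I\<close> be the ideal of Leavitt relations in the free algebra and \<open>J \<supseteq> I\<close> the set of all
  elements whose class is killed by \<open>\<pi>\<close>. Then \<open>J\<close> is an ideal that contains no vertex, and
  injectivity of \<open>\<pi>\<close> says \<open>J = I\<close> (lemma \<open>vertex_free_ideal_trivial\<close>). All computations take
  place in the free algebra modulo \<open>I\<close>; the hypothesis on \<open>\<pi>\<close> makes the vertices nonzero modulo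
  \<open>J\<close>, hence modulo \<open>I\<close>.

  Condition (L) enters in \<open>vertex_plus_loops_notin\<close>: an element
  \<open>k v + \<Sum> c\<^sub>i \<gamma>\<^sub>i\<close> with \<open>k \<noteq> 0\<close> and closed paths \<open>\<gamma>\<^sub>i\<close> of positive length at \<open>v\<close> never lies in
  \<open>J\<close>. Compress it to \<open>\<tau>\<^sup>* (\<dots>) \<tau>\<close>, where the path \<open>\<tau>\<close> follows \<open>\<gamma>\<^sub>1\<close> for a while and then leaves it
  by an exit. The vertex \<open>v\<close> becomes the range of \<open>\<tau>\<close>, the term \<open>\<tau>\<^sup>* \<gamma>\<^sub>1 \<tau>\<close> vanishes, and each
  other \<open>\<tau>\<^sup>* \<gamma>\<^sub>i \<tau>\<close> vanishes or is again a closed path of positive length. So the number of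
  loops drops, and when none is left a multiple of a vertex remains, which \<open>J\<close> does not contain.

  It follows (\<open>path_sum_in_J\<close>) that a linear combination of distinct paths with common range
  lies in \<open>J\<close> only if all coefficients vanish: multiply by \<open>\<alpha>\<^sup>*\<close> on the left, where \<open>\<alpha>\<close> is a
  shortest path that occurs.

  For arbitrary elements one lowers the number of ghost edges (\<open>ghost_filtration_in_J_zero\<close>).
  Modulo \<open>I\<close>, an element \<open>f\<close> of \<open>J\<close> satisfies \<open>f v = (\<Sum>e\<in>S. a\<^sub>e e\<^sup>*) + q\<close> with \<open>S\<close> a finite set of
  edges leaving \<open>v\<close> and \<open>q\<close> a combination of paths. Multiplication by an edge \<open>e\<close> leaving \<open>v\<close>
  removes a ghost edge, so by induction \<open>f e = 0\<close> modulo \<open>I\<close>, which makes \<open>a\<^sub>e e\<^sup>* = - q e e\<^sup>*\<close> and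
  hence \<open>f v = q (v - (\<Sum>e\<in>S. e e\<^sup>*))\<close>. If \<open>S\<close> contains all edges leaving \<open>v\<close> and is not empty,
  the last relation at the regular vertex \<open>v\<close> makes this zero. If an edge \<open>g\<close> leaving \<open>v\<close> is not
  in \<open>S\<close>, then \<open>q g = f g = 0\<close>, and independence of paths gives \<open>q = 0\<close>. If \<open>v\<close> emits no edge,
  then \<open>f v = q\<close> lies in \<open>J\<close> and again \<open>q = 0\<close>. Local units then give \<open>f = 0\<close> modulo \<open>I\<close>.
\<close>

section \<open>Calculating modulo the Leavitt relations\<close>

lemma scale_mult_left: "scale c (f * g) = scale c f * g"
  by (simp add: scale_def mult.assoc)

lemma sum_single_lookup:
  fixes f :: "'a \<Rightarrow>\<^sub>0 'b::comm_monoid_add"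
  shows "(\<Sum>w\<in>Poly_Mapping.keys f. Poly_Mapping.single w (Poly_Mapping.lookup f w)) = f"
proof (rule poly_mapping_eqI)
  fix w
  have "Poly_Mapping.lookup
        (\<Sum>w\<in>Poly_Mapping.keys f. Poly_Mapping.single w (Poly_Mapping.lookup f w)) w
      = (\<Sum>u\<in>Poly_Mapping.keys f. if w = u then Poly_Mapping.lookup f u else 0)"
    by (simp add: Poly_Mapping.lookup_sum lookup_single when_def eq_commute)
  then show "Poly_Mapping.lookup
        (\<Sum>w\<in>Poly_Mapping.keys f. Poly_Mapping.single w (Poly_Mapping.lookup f w)) w
      = Poly_Mapping.lookup f w"
    by (simp add: in_keys_iff)
qed

lemma scalar_central:
  "f * Poly_Mapping.single 0 c = Poly_Mapping.single 0 c * (f :: ('v, 'e, 'k::field) ncpoly)"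
proof -
  have "f * Poly_Mapping.single 0 c
      = (\<Sum>w\<in>Poly_Mapping.keys f. Poly_Mapping.single w (Poly_Mapping.lookup f w))
        * Poly_Mapping.single 0 c"
    by (simp only: sum_single_lookup)
  also have "\<dots> = Poly_Mapping.single 0 c
      * (\<Sum>w\<in>Poly_Mapping.keys f. Poly_Mapping.single w (Poly_Mapping.lookup f w))"
    by (simp add: sum_distrib_left sum_distrib_right mult_single mult.commute)
  finally show ?thesis
    by (simp only: sum_single_lookup)
qed

lemma scale_mult_right: "f * scale c g = scale c (f * g)"
  unfolding scale_def by (simp only: scalar_central flip: mult.assoc)

lemma scale_diff: "scale c (f - g) = scale c f - scale c g"
  by (simp add: scale_def algebra_simps)

lemma scale_sum: "scale c (sum f A) = (\<Sum>x\<in>A. scale c (f x))"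
  by (simp add: scale_def sum_distrib_left)

lemma scale_scale: "scale c (scale d f) = scale (c * d) f"
  by (simp add: scale_def mult_single flip: mult.assoc)

lemma scale_one [simp]: "scale 1 f = f"
  by (simp add: scale_def)

lemma scale_zero [simp]: "scale 0 f = 0" "scale c 0 = 0"
  by (simp_all add: scale_def)

lemma scale_add_left: "scale (c + d) f = scale c f + scale d f"
  by (simp add: scale_def single_add algebra_simps)

lemma sum_closed_free_algebra:
  "(\<And>x. x \<in> A \<Longrightarrow> f x \<in> carrier (free_algebra E)) \<Longrightarrow> sum f A \<in> carrier (free_algebra E)"
  by (induction A rule: infinite_finite_induct) (auto intro: free_algebra_closed)

text \<open>
  Right multiplication by a generator builds every monomial letter by letter, which is
  the form of induction that suits normal forms with all ghost edges on the right.
\<close>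

lemma free_algebra_induct [consumes 1, case_names zero add scale gen mult]:
  fixes f :: "('v, 'e, 'k::field) ncpoly"
  assumes f: "f \<in> carrier (free_algebra E)"
    and zero: "P 0"
    and add: "\<And>g h. \<lbrakk>g \<in> carrier (free_algebra E); h \<in> carrier (free_algebra E); P g; P h\<rbrakk> \<Longrightarrow> P (g + h)"
    and scale: "\<And>c g. \<lbrakk>g \<in> carrier (free_algebra E); P g\<rbrakk> \<Longrightarrow> P (scale c g)"
    and gen: "\<And>x. x \<in> generators E \<Longrightarrow> P (Poly_Mapping.single (Word [x]) 1)"
    and mult: "\<And>g x. \<lbrakk>g \<in> carrier (free_algebra E); P g; x \<in> generators E\<rbrakk>
      \<Longrightarrow> P (g * Poly_Mapping.single (Word [x]) 1)"
  shows "P f"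
proof -
  have word: "P (Poly_Mapping.single (Word xs) 1)" if "xs \<noteq> []" "set xs \<subseteq> generators E" for xs
    using that
  proof (induction xs rule: rev_nonempty_induct)
    case (snoc x xs)
    have "P (Poly_Mapping.single (Word xs) 1 * Poly_Mapping.single (Word [x]) 1)"
      using snoc by (intro mult) (auto simp: free_algebra_def)
    then show ?case
      by (simp add: mult_single plus_word_def)
  qed (simp add: gen)
  have mono: "P (Poly_Mapping.single w c)"
    if "w \<in> Poly_Mapping.keys f" for w c
  proof -
    have w: "letters w \<noteq> []" "set (letters w) \<subseteq> generators E"
      using f that by (auto simp: free_algebra_def)
    then have "P (scale c (Poly_Mapping.single (Word (letters w)) 1))"
      by (intro scale word) (auto simp: free_algebra_def)
    then show ?thesis
      by (simp add: scale_def mult_single)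
  qed
  have "P (\<Sum>w\<in>A. Poly_Mapping.single w (Poly_Mapping.lookup f w))
      \<and> (\<Sum>w\<in>A. Poly_Mapping.single w (Poly_Mapping.lookup f w)) \<in> carrier (free_algebra E)"
    if "finite A" "A \<subseteq> Poly_Mapping.keys f" for A
    using that
  proof (induction A rule: finite_induct)
    case (insert w A)
    moreover have "Poly_Mapping.single w (Poly_Mapping.lookup f w) \<in> carrier (free_algebra E)"
      using f insert.prems by (auto simp: free_algebra_def)
    ultimately show ?case
      by (auto intro!: add mono free_algebra_closed)
  qed (auto intro: zero free_algebra_closed)
  from this[of "Poly_Mapping.keys f"] show ?thesis
    by (simp add: sum_single_lookup)
qed

text \<open>
  The parameter \<open>K\<close> only fixes the coefficient field \<open>'k\<close>, so that all elements in the
  lemmas below have coefficients in one and the same field.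
\<close>

locale leavitt_graph = wf_digraph E for E :: "('v, 'e) pre_digraph" +
  fixes K :: "'k::field itself"
begin

definition lcong :: "('v, 'e, 'k) ncpoly \<Rightarrow> ('v, 'e, 'k) ncpoly \<Rightarrow> bool" (infix "\<approx>" 50) where
  "f \<approx> g \<longleftrightarrow> f - g \<in> leavitt_ideal E"

lemma leavitt_ideal_minus:
  "x \<in> leavitt_ideal E \<Longrightarrow> - x \<in> leavitt_ideal E"
  by (rule leavitt_ideal_uminus[OF wf_digraph])

lemma lcong_refl [simp, intro]: "x \<approx> x"
  by (simp add: lcong_def leavitt_ideal.zero)

lemma lcong_sym: "x \<approx> y \<Longrightarrow> y \<approx> x"
  unfolding lcong_def by (metis leavitt_ideal_minus minus_diff_eq)

lemma lcong_trans [trans]: "x \<approx> y \<Longrightarrow> y \<approx> z \<Longrightarrow> x \<approx> z"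
  unfolding lcong_def using leavitt_ideal.add[of "x - y" E "y - z"] by simp

lemma lcong_add: "x \<approx> y \<Longrightarrow> x' \<approx> y' \<Longrightarrow> x + x' \<approx> y + y'"
  unfolding lcong_def using leavitt_ideal.add[of "x - y" E "x' - y'"] by (simp add: algebra_simps)

lemma lcong_minus: "x \<approx> y \<Longrightarrow> - x \<approx> - y"
  unfolding lcong_def using leavitt_ideal_minus[of "x - y"] by (simp add: algebra_simps)

lemma lcong_diff: "x \<approx> y \<Longrightarrow> x' \<approx> y' \<Longrightarrow> x - x' \<approx> y - y'"
  using lcong_add[of x y "- x'" "- y'"] lcong_minus[of x' y'] by simp

lemma lcong_scale: "x \<approx> y \<Longrightarrow> scale c x \<approx> scale c y"
  unfolding lcong_def by (metis leavitt_ideal.scale scale_diff)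

lemma lcong_sum: "(\<And>i. i \<in> A \<Longrightarrow> f i \<approx> g i) \<Longrightarrow> sum f A \<approx> sum g A"
  by (induction A rule: infinite_finite_induct) (auto intro: lcong_add)

lemma lcong_mult_left: "a \<in> carrier (free_algebra E) \<Longrightarrow> x \<approx> y \<Longrightarrow> a * x \<approx> a * y"
  unfolding lcong_def using leavitt_ideal.mult_left[of a E "x - y"] by (simp add: algebra_simps)

lemma lcong_mult_right: "a \<in> carrier (free_algebra E) \<Longrightarrow> x \<approx> y \<Longrightarrow> x * a \<approx> y * a"
  unfolding lcong_def using leavitt_ideal.mult_right[of "x - y" E a] by (simp add: algebra_simps)

lemma lcong_zero_iff: "x \<approx> 0 \<longleftrightarrow> x \<in> leavitt_ideal E"
  by (simp add: lcong_def)

lemma relator_lcong: "x - y \<in> leavitt_relators E \<Longrightarrow> x \<approx> y"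
  unfolding lcong_def by (rule leavitt_ideal.relator)

lemmas gen_closed [simp, intro] = generators_closed[of _ E]

lemma vtx_vtx:
  "v \<in> verts E \<Longrightarrow> w \<in> verts E \<Longrightarrow> vtx v * vtx w \<approx> (if v = w then vtx v else 0)"
  by (rule relator_lcong) (unfold leavitt_relators_def, blast)

lemma tail_edge: "e \<in> arcs E \<Longrightarrow> vtx (tail E e) * edge e \<approx> edge e"
  by (rule relator_lcong) (unfold leavitt_relators_def, blast)

lemma edge_head: "e \<in> arcs E \<Longrightarrow> edge e * vtx (head E e) \<approx> edge e"
  by (rule relator_lcong) (unfold leavitt_relators_def, blast)

lemma head_ghost: "e \<in> arcs E \<Longrightarrow> vtx (head E e) * ghost e \<approx> ghost e"
  by (rule relator_lcong) (unfold leavitt_relators_def, blast)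

lemma ghost_tail: "e \<in> arcs E \<Longrightarrow> ghost e * vtx (tail E e) \<approx> ghost e"
  by (rule relator_lcong) (unfold leavitt_relators_def, blast)

lemma ghost_edge:
  "e \<in> arcs E \<Longrightarrow> f \<in> arcs E \<Longrightarrow> ghost e * edge f \<approx> (if e = f then vtx (head E e) else 0)"
  by (rule relator_lcong) (unfold leavitt_relators_def, blast)

lemma regular_vtx:
  "regular_vertex E v \<Longrightarrow> vtx v \<approx> (\<Sum>e\<in>out_arcs E v. edge e * ghost e)"
  by (rule relator_lcong) (unfold leavitt_relators_def, blast)

lemma vtx_edge:
  assumes "u \<in> verts E" "e \<in> arcs E"
  shows "vtx u * edge e \<approx> (if u = tail E e then edge e else 0)"
proof -
  have "vtx u * edge e \<approx> vtx u * (vtx (tail E e) * edge e)"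
    using assms by (intro lcong_mult_left lcong_sym[OF tail_edge]) auto
  also have "\<dots> = (vtx u * vtx (tail E e)) * edge e"
    by (simp add: mult.assoc)
  also have "\<dots> \<approx> (if u = tail E e then vtx u else 0) * edge e"
    using assms by (intro lcong_mult_right vtx_vtx) auto
  also have "\<dots> \<approx> (if u = tail E e then edge e else 0)"
    using tail_edge[OF assms(2)] by (cases "u = tail E e") simp_all
  finally show ?thesis .
qed

lemma edge_vtx:
  assumes "u \<in> verts E" "e \<in> arcs E"
  shows "edge e * vtx u \<approx> (if u = head E e then edge e else 0)"
proof -
  have "edge e * vtx u \<approx> (edge e * vtx (head E e)) * vtx u"
    using assms by (intro lcong_mult_right lcong_sym[OF edge_head]) auto
  also have "\<dots> = edge e * (vtx (head E e) * vtx u)"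
    by (simp add: mult.assoc)
  also have "\<dots> \<approx> edge e * (if head E e = u then vtx (head E e) else 0)"
    using assms by (intro lcong_mult_left vtx_vtx) auto
  also have "\<dots> \<approx> (if u = head E e then edge e else 0)"
    using edge_head[OF assms(2)] by (cases "u = head E e") simp_all
  finally show ?thesis .
qed

lemma ghost_vtx:
  assumes "u \<in> verts E" "e \<in> arcs E"
  shows "ghost e * vtx u \<approx> (if u = tail E e then ghost e else 0)"
proof -
  have "ghost e * vtx u \<approx> (ghost e * vtx (tail E e)) * vtx u"
    using assms by (intro lcong_mult_right lcong_sym[OF ghost_tail]) auto
  also have "\<dots> = ghost e * (vtx (tail E e) * vtx u)"
    by (simp add: mult.assoc)
  also have "\<dots> \<approx> ghost e * (if tail E e = u then vtx (tail E e) else 0)"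
    using assms by (intro lcong_mult_left vtx_vtx) auto
  also have "\<dots> \<approx> (if u = tail E e then ghost e else 0)"
    using ghost_tail[OF assms(2)] by (cases "u = tail E e") simp_all
  finally show ?thesis .
qed

section \<open>Multiplying paths and ghost paths\<close>

text \<open>
  A path \<open>\<alpha>\<close> and its ghost path \<open>\<alpha>\<^sup>*\<close>. The factor for the range \<open>v\<close> of \<open>\<alpha>\<close> changes nothing modulo the relations if \<open>\<alpha>\<close> is not empty; it makes the empty path
  at \<open>v\<close> an element of the nonunital free algebra, namely the vertex \<open>v\<close>.
\<close>

definition path_mon :: "'e list \<Rightarrow> 'v \<Rightarrow> ('v, 'e, 'k) ncpoly" where
  "path_mon \<alpha> v = prod_list (map edge \<alpha>) * vtx v"

definition ghost_mon :: "'e list \<Rightarrow> 'v \<Rightarrow> ('v, 'e, 'k) ncpoly" where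
  "ghost_mon \<alpha> v = vtx v * prod_list (map ghost (rev \<alpha>))"

lemma path_mon_simps [simp]:
  "path_mon [] v = vtx v" "path_mon (e # \<alpha>) v = edge e * path_mon \<alpha> v"
  by (simp_all add: path_mon_def mult.assoc)

lemma ghost_mon_simps [simp]:
  "ghost_mon [] v = vtx v" "ghost_mon (e # \<alpha>) v = ghost_mon \<alpha> v * ghost e"
  by (simp_all add: ghost_mon_def mult.assoc)

lemma path_mon_closed: "awalk u \<alpha> v \<Longrightarrow> path_mon \<alpha> v \<in> carrier (free_algebra E)"
  by (induction \<alpha> arbitrary: u)
    (auto simp: awalk_simps intro: free_algebra_closed gen_closed)

lemma ghost_mon_closed: "awalk u \<alpha> v \<Longrightarrow> ghost_mon \<alpha> v \<in> carrier (free_algebra E)"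
  by (induction \<alpha> arbitrary: u)
    (auto simp: awalk_simps intro: free_algebra_closed gen_closed)

lemma vtx_path_mon:
  assumes "awalk u \<alpha> v" "x \<in> verts E"
  shows "vtx x * path_mon \<alpha> v \<approx> (if x = u then path_mon \<alpha> v else 0)"
proof (cases \<alpha>)
  case Nil
  then show ?thesis
    using assms vtx_vtx[of x v] by (cases "x = v") (auto simp: awalk_simps)
next
  case (Cons e \<beta>)
  then have e: "e \<in> arcs E" "tail E e = u" "awalk (head E e) \<beta> v"
    using assms by (auto simp: awalk_simps)
  have "vtx x * path_mon \<alpha> v = (vtx x * edge e) * path_mon \<beta> v"
    using Cons by (simp add: mult.assoc)
  also have "\<dots> \<approx> (if x = tail E e then edge e else 0) * path_mon \<beta> v"
    using e assms by (intro lcong_mult_right vtx_edge path_mon_closed)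
  also have "\<dots> = (if x = u then path_mon \<alpha> v else 0)"
    using e Cons by auto
  finally show ?thesis .
qed

lemma path_mon_vtx:
  assumes "awalk u \<alpha> v" "x \<in> verts E"
  shows "path_mon \<alpha> v * vtx x \<approx> (if x = v then path_mon \<alpha> v else 0)"
  using assms
proof (induction \<alpha> arbitrary: u)
  case Nil
  then show ?case
    using vtx_vtx[of v x] by (cases "x = v") (auto simp: awalk_simps)
next
  case (Cons e \<alpha>)
  then have "edge e * (path_mon \<alpha> v * vtx x) \<approx> edge e * (if x = v then path_mon \<alpha> v else 0)"
    by (intro lcong_mult_left) (auto simp: awalk_simps)
  then show ?case
    by (auto simp: mult.assoc split: if_splits)
qed

lemma path_mon_mult:
  assumes "awalk u \<alpha> v" "awalk v \<beta> w"
  shows "path_mon \<alpha> v * path_mon \<beta> w \<approx> path_mon (\<alpha> @ \<beta>) w"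
  using assms
proof (induction \<alpha> arbitrary: u)
  case Nil
  then show ?case
    using vtx_path_mon[of v \<beta> w v] by (auto simp: awalk_simps)
next
  case (Cons e \<alpha>)
  then have "edge e * (path_mon \<alpha> v * path_mon \<beta> w) \<approx> edge e * path_mon (\<alpha> @ \<beta>) w"
    by (intro lcong_mult_left) (auto simp: awalk_simps)
  then show ?case
    by (simp add: mult.assoc)
qed

text \<open>
  Cancelling \<open>e\<^sup>* f = \<delta>\<^sub>e\<^sub>f r(e)\<close> from the inside out compares \<open>\<alpha>\<close> and \<open>\<beta>\<close> edge by edge. Either
  \<open>\<alpha>\<close> is used up and the rest \<open>\<gamma>\<close> of \<open>\<beta>\<close> remains, or the product vanishes; for \<open>\<alpha> = []\<close> the
  product vanishes when \<open>\<beta>\<close> starts at another vertex.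
\<close>

lemma ghost_path_mult:
  assumes "awalk u \<alpha> v" "awalk u' \<beta> w" "length \<alpha> \<le> length \<beta>"
  shows "(\<exists>\<gamma>. \<beta> = \<alpha> @ \<gamma> \<and> awalk v \<gamma> w \<and> ghost_mon \<alpha> v * path_mon \<beta> w \<approx> path_mon \<gamma> w)
    \<or> ghost_mon \<alpha> v * path_mon \<beta> w \<approx> 0"
  using assms
proof (induction \<alpha> arbitrary: u u' \<beta>)
  case Nil
  then show ?case
    using vtx_path_mon[of u' \<beta> w v] by (cases "v = u'") (auto simp: awalk_simps)
next
  case (Cons e \<alpha>)
  then obtain f \<beta>' where \<beta>: "\<beta> = f # \<beta>'"
    by (cases \<beta>) auto
  have e: "e \<in> arcs E" "awalk (head E e) \<alpha> v" and f: "f \<in> arcs E" "awalk (head E f) \<beta>' w"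
    using Cons.prems \<beta> by (auto simp: awalk_simps)
  have closed: "ghost_mon \<alpha> v \<in> carrier (free_algebra E)" "path_mon \<beta>' w \<in> carrier (free_algebra E)"
    using e f ghost_mon_closed path_mon_closed by blast+
  have "ghost_mon (e # \<alpha>) v * path_mon \<beta> w = ghost_mon \<alpha> v * ((ghost e * edge f) * path_mon \<beta>' w)"
    by (simp add: \<beta> mult.assoc)
  also have "\<dots> \<approx> ghost_mon \<alpha> v * ((if e = f then vtx (head E e) else 0) * path_mon \<beta>' w)"
    using closed e f by (intro lcong_mult_left lcong_mult_right ghost_edge)
  finally have prod: "ghost_mon (e # \<alpha>) v * path_mon \<beta> w
      \<approx> ghost_mon \<alpha> v * ((if e = f then vtx (head E e) else 0) * path_mon \<beta>' w)" .
  show ?case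
  proof (cases "e = f")
    case True
    have "vtx (head E e) * path_mon \<beta>' w \<approx> path_mon \<beta>' w"
      using vtx_path_mon[OF f(2), of "head E e"] e True by auto
    then have "ghost_mon \<alpha> v * (vtx (head E e) * path_mon \<beta>' w) \<approx> ghost_mon \<alpha> v * path_mon \<beta>' w"
      by (intro lcong_mult_left closed)
    with prod True have *: "ghost_mon (e # \<alpha>) v * path_mon \<beta> w \<approx> ghost_mon \<alpha> v * path_mon \<beta>' w"
      using lcong_trans by auto
    have "(\<exists>\<gamma>. \<beta>' = \<alpha> @ \<gamma> \<and> awalk v \<gamma> w \<and> ghost_mon \<alpha> v * path_mon \<beta>' w \<approx> path_mon \<gamma> w)
        \<or> ghost_mon \<alpha> v * path_mon \<beta>' w \<approx> 0"
      using Cons.IH[OF e(2) f(2)] Cons.prems \<beta> by simp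
    then show ?thesis
      using lcong_trans[OF *] \<beta> True by auto
  qed (use prod in auto)
qed

lemma ghost_path_cancel:
  assumes "awalk u \<alpha> v"
  shows "ghost_mon \<alpha> v * path_mon \<alpha> v \<approx> vtx v"
  using assms
proof (induction \<alpha> arbitrary: u)
  case Nil
  then show ?case
    using vtx_vtx[of v v] by (auto simp: awalk_simps)
next
  case (Cons e \<alpha>)
  then have e: "e \<in> arcs E" "awalk (head E e) \<alpha> v"
    by (auto simp: awalk_simps)
  have "ghost_mon (e # \<alpha>) v * path_mon (e # \<alpha>) v = ghost_mon \<alpha> v * ((ghost e * edge e) * path_mon \<alpha> v)"
    by (simp add: mult.assoc)
  also have "\<dots> \<approx> ghost_mon \<alpha> v * (vtx (head E e) * path_mon \<alpha> v)"
    using ghost_edge[of e e] e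
    by (intro lcong_mult_left lcong_mult_right) (auto intro: ghost_mon_closed path_mon_closed)
  also have "\<dots> \<approx> ghost_mon \<alpha> v * path_mon \<alpha> v"
    using vtx_path_mon[OF e(2), of "head E e"] e
    by (intro lcong_mult_left) (auto intro: ghost_mon_closed)
  also have "\<dots> \<approx> vtx v"
    by (rule Cons.IH[OF e(2)])
  finally show ?case .
qed

text \<open>
  Lists with possible repetitions serve better than sets of closed paths: compression then acts
  on each summand separately, and the length of the list is the induction measure.
\<close>

definition loop_sum :: "('k \<times> 'e list) list \<Rightarrow> 'v \<Rightarrow> ('v, 'e, 'k) ncpoly" where
  "loop_sum xs v = (\<Sum>(c, \<gamma>)\<leftarrow>xs. scale c (path_mon \<gamma> v))"

definition loops_at :: "'v \<Rightarrow> ('k \<times> 'e list) list \<Rightarrow> bool" where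
  "loops_at v xs \<longleftrightarrow> (\<forall>(c, \<gamma>)\<in>set xs. awalk v \<gamma> v \<and> \<gamma> \<noteq> [])"

lemma loop_sum_simps [simp]:
  "loop_sum [] v = 0" "loop_sum ((c, \<gamma>) # xs) v = scale c (path_mon \<gamma> v) + loop_sum xs v"
  by (simp_all add: loop_sum_def)

lemma loops_at_simps [simp]:
  "loops_at v []" "loops_at v ((c, \<gamma>) # xs) \<longleftrightarrow> awalk v \<gamma> v \<and> \<gamma> \<noteq> [] \<and> loops_at v xs"
  by (auto simp: loops_at_def)

text \<open>
  The product is \<open>\<tau>\<^sup>*\<close> times the path \<open>\<gamma> \<tau>\<close>, so it survives only if \<open>\<gamma> \<tau> = \<tau> \<gamma>'\<close>. Comparing lengths
  shows that \<open>\<gamma>'\<close> is not empty: compression never turns a loop into a vertex.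
\<close>

lemma compress_loop:
  assumes \<gamma>: "awalk v \<gamma> v" "\<gamma> \<noteq> []" and \<tau>: "awalk v \<tau> w"
  shows "(\<exists>\<gamma>'. \<gamma> @ \<tau> = \<tau> @ \<gamma>' \<and> awalk w \<gamma>' w \<and> \<gamma>' \<noteq> []
        \<and> ghost_mon \<tau> w * path_mon \<gamma> v * path_mon \<tau> w \<approx> path_mon \<gamma>' w)
    \<or> ghost_mon \<tau> w * path_mon \<gamma> v * path_mon \<tau> w \<approx> 0"
proof -
  have "ghost_mon \<tau> w * (path_mon \<gamma> v * path_mon \<tau> w) \<approx> ghost_mon \<tau> w * path_mon (\<gamma> @ \<tau>) w"
    using assms by (intro lcong_mult_left path_mon_mult ghost_mon_closed)
  then have *: "ghost_mon \<tau> w * path_mon \<gamma> v * path_mon \<tau> w \<approx> ghost_mon \<tau> w * path_mon (\<gamma> @ \<tau>) w"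
    by (simp add: mult.assoc)
  have "awalk v (\<gamma> @ \<tau>) w" "length \<tau> \<le> length (\<gamma> @ \<tau>)"
    using assms by (auto intro: awalk_appendI)
  from ghost_path_mult[OF \<tau> this] show ?thesis
  proof (elim disjE exE conjE)
    fix \<gamma>'
    assume \<gamma>': "\<gamma> @ \<tau> = \<tau> @ \<gamma>'" "awalk w \<gamma>' w"
      "ghost_mon \<tau> w * path_mon (\<gamma> @ \<tau>) w \<approx> path_mon \<gamma>' w"
    then have "length \<gamma>' = length \<gamma>"
      by (metis add_left_cancel add.commute length_append)
    with \<gamma>(2) have "\<gamma>' \<noteq> []"
      by auto
    with \<gamma>' show ?thesis
      using lcong_trans[OF * \<gamma>'(3)] by blast
  qed (use lcong_trans[OF *] in blast)
qed

lemma compress_loop_sum: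
  assumes "loops_at v xs" and \<tau>: "awalk v \<tau> w"
  shows "\<exists>ys. length ys \<le> length xs \<and> loops_at w ys
    \<and> ghost_mon \<tau> w * loop_sum xs v * path_mon \<tau> w \<approx> loop_sum ys w"
  using assms(1)
proof (induction xs)
  case (Cons x xs)
  obtain c \<gamma> where x: "x = (c, \<gamma>)"
    by (cases x)
  with Cons obtain ys where ys: "length ys \<le> length xs" "loops_at w ys"
    "ghost_mon \<tau> w * loop_sum xs v * path_mon \<tau> w \<approx> loop_sum ys w"
    by auto
  have \<gamma>: "awalk v \<gamma> v" "\<gamma> \<noteq> []"
    using Cons.prems x by auto
  have split: "ghost_mon \<tau> w * loop_sum (x # xs) v * path_mon \<tau> w
      = scale c (ghost_mon \<tau> w * path_mon \<gamma> v * path_mon \<tau> w) + ghost_mon \<tau> w * loop_sum xs v * path_mon \<tau> w"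
    by (simp add: x algebra_simps scale_mult_right flip: scale_mult_left)
  from compress_loop[OF \<gamma> \<tau>] show ?case
  proof (elim disjE exE conjE)
    fix \<gamma>'
    assume "awalk w \<gamma>' w" "\<gamma>' \<noteq> []"
      and *: "ghost_mon \<tau> w * path_mon \<gamma> v * path_mon \<tau> w \<approx> path_mon \<gamma>' w"
    moreover have "ghost_mon \<tau> w * loop_sum (x # xs) v * path_mon \<tau> w \<approx> loop_sum ((c, \<gamma>') # ys) w"
      unfolding split loop_sum_simps by (intro lcong_add lcong_scale * ys)
    ultimately show ?thesis
      using ys by (intro exI[of _ "(c, \<gamma>') # ys"]) simp
  next
    assume *: "ghost_mon \<tau> w * path_mon \<gamma> v * path_mon \<tau> w \<approx> 0"
    have "ghost_mon \<tau> w * loop_sum (x # xs) v * path_mon \<tau> w \<approx> scale c 0 + loop_sum ys w"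
      unfolding split by (intro lcong_add lcong_scale * ys)
    then show ?thesis
      using ys by (intro exI[of _ ys]) auto
  qed
qed (auto intro!: exI[of _ "[]"])

text \<open>
  This is the form in which Condition (L) is used: follow \<open>\<gamma>\<close> until the exit leaves it.
\<close>

lemma exit_path:
  assumes L: "condition_L E" and \<gamma>: "awalk v \<gamma> v" "\<gamma> \<noteq> []"
  shows "\<exists>\<tau> w. awalk v \<tau> w \<and> length \<tau> \<le> length \<gamma> \<and> take (length \<tau>) \<gamma> \<noteq> \<tau>"
proof -
  have "closed_w \<gamma>"
    using \<gamma> by (auto simp: closed_w_def)
  then obtain f i where f: "f \<in> arcs E" "i < length \<gamma>" "tail E f = tail E (\<gamma> ! i)" "f \<noteq> \<gamma> ! i"
    using L by (auto simp: condition_L_def exit_of_def)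
  have "awalk v (take i \<gamma> @ \<gamma> ! i # drop (Suc i) \<gamma>) v"
    using \<gamma> f(2) by (simp add: id_take_nth_drop[symmetric])
  then have "awalk v (take i \<gamma>) (tail E f)"
    using f by (auto simp: awalk_Cons_iff)
  then have "awalk v (take i \<gamma> @ [f]) (head E f)"
    by (rule awalk_appendI[OF _ arc_implies_awalk[OF f(1)]])
  moreover have "take (length (take i \<gamma> @ [f])) \<gamma> \<noteq> take i \<gamma> @ [f]"
    using f by (auto simp: take_Suc_conv_app_nth)
  ultimately show ?thesis
    using f by (intro exI[of _ "take i \<gamma> @ [f]"]) auto
qed

section \<open>Normal forms with ghost edges on the right\<close>

definition path_form :: "'v \<Rightarrow> ('v, 'e, 'k) ncpoly \<Rightarrow> bool" where
  "path_form v q \<longleftrightarrow> (\<exists>T c. finite T \<and> (\<forall>\<alpha>\<in>T. \<exists>u. awalk u \<alpha> v)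
     \<and> q = (\<Sum>\<alpha>\<in>T. scale (c \<alpha>) (path_mon \<alpha> v)))"

text \<open>
  The predicate describes elements \<open>x\<close> with \<open>x = x v\<close> that need at most \<open>d\<close> ghost edges on the
  right of each monomial: modulo the relations they are \<open>(\<Sum>e\<in>S. a\<^sub>e e\<^sup>*) + q\<close> with \<open>q\<close> a
  combination of paths and coefficients \<open>a\<^sub>e\<close> that need one ghost edge less. Such forms are
  not unique.
\<close>

primrec normal_at :: "nat \<Rightarrow> 'v \<Rightarrow> ('v, 'e, 'k) ncpoly \<Rightarrow> bool" where
  "normal_at 0 v x \<longleftrightarrow> (\<exists>q. path_form v q \<and> x \<approx> q)"
| "normal_at (Suc d) v x \<longleftrightarrow> (\<exists>S a q. finite S \<and> S \<subseteq> out_arcs E v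
     \<and> (\<forall>e\<in>S. a e \<in> carrier (free_algebra E) \<and> (\<forall>w\<in>verts E. normal_at d w (a e * vtx w)))
     \<and> path_form v q \<and> x \<approx> (\<Sum>e\<in>S. a e * ghost e) + q)"

definition ghost_filtration :: "nat \<Rightarrow> ('v, 'e, 'k) ncpoly set" where
  "ghost_filtration d =
     {f \<in> carrier (free_algebra E). \<forall>v\<in>verts E. normal_at d v (f * vtx v)}"

lemma normal_at_Suc_iff:
  "normal_at (Suc d) v x \<longleftrightarrow> (\<exists>S a q. finite S \<and> S \<subseteq> out_arcs E v
     \<and> (\<forall>e\<in>S. a e \<in> ghost_filtration d) \<and> path_form v q \<and> x \<approx> (\<Sum>e\<in>S. a e * ghost e) + q)"
  by (simp add: ghost_filtration_def)

declare normal_at.simps(2) [simp del]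

lemma path_form_closed: "path_form v q \<Longrightarrow> q \<in> carrier (free_algebra E)"
  unfolding path_form_def
  by (auto intro!: sum_closed_free_algebra free_algebra_closed intro: path_mon_closed)

lemma path_form_zero: "path_form v 0"
  unfolding path_form_def by (intro exI[of _ "{}"]) simp

lemma path_form_vtx: "v \<in> verts E \<Longrightarrow> path_form v (vtx v)"
  unfolding path_form_def
  by (intro exI[of _ "{[]}"] exI[of _ "\<lambda>_. 1"]) (auto simp: awalk_Nil_iff)

lemma path_form_scale: "path_form v q \<Longrightarrow> path_form v (scale c q)"
  unfolding path_form_def by (force simp: scale_sum scale_scale)

text \<open>
  Both sums are extended by zero coefficients to the union of the two sets of paths.
\<close>

lemma path_form_add:
  assumes "path_form v q" "path_form v r"
  shows "path_form v (q + r)"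
proof -
  obtain T c where T: "finite T" "\<forall>\<alpha>\<in>T. \<exists>u. awalk u \<alpha> v"
    "q = (\<Sum>\<alpha>\<in>T. scale (c \<alpha>) (path_mon \<alpha> v))"
    using assms(1) unfolding path_form_def by blast
  obtain U d where U: "finite U" "\<forall>\<alpha>\<in>U. \<exists>u. awalk u \<alpha> v"
    "r = (\<Sum>\<alpha>\<in>U. scale (d \<alpha>) (path_mon \<alpha> v))"
    using assms(2) unfolding path_form_def by blast
  define c' where "c' = (\<lambda>\<alpha>. if \<alpha> \<in> T then c \<alpha> else 0)"
  define d' where "d' = (\<lambda>\<alpha>. if \<alpha> \<in> U then d \<alpha> else 0)"
  have "q = (\<Sum>\<alpha>\<in>T \<union> U. scale (c' \<alpha>) (path_mon \<alpha> v))"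
    unfolding T(3) c'_def using T(1) U(1) by (intro sum.mono_neutral_cong_left) auto
  moreover have "r = (\<Sum>\<alpha>\<in>T \<union> U. scale (d' \<alpha>) (path_mon \<alpha> v))"
    unfolding U(3) d'_def using T(1) U(1) by (intro sum.mono_neutral_cong_left) auto
  ultimately have "q + r = (\<Sum>\<alpha>\<in>T \<union> U. scale (c' \<alpha> + d' \<alpha>) (path_mon \<alpha> v))"
    by (simp add: scale_add_left sum.distrib)
  moreover have "\<forall>\<alpha>\<in>T \<union> U. \<exists>u. awalk u \<alpha> v"
    using T(2) U(2) by blast
  ultimately show ?thesis
    unfolding path_form_def using T(1) U(1)
    by (intro exI[of _ "T \<union> U"] exI[of _ "\<lambda>\<alpha>. c' \<alpha> + d' \<alpha>"]) auto
qed

lemma path_form_mult_vtx: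
  assumes "path_form v q"
  shows "q * vtx v \<approx> q"
proof -
  obtain T c where T: "finite T" "\<forall>\<alpha>\<in>T. \<exists>u. awalk u \<alpha> v"
    "q = (\<Sum>\<alpha>\<in>T. scale (c \<alpha>) (path_mon \<alpha> v))"
    using assms unfolding path_form_def by blast
  have "path_mon \<alpha> v * vtx v \<approx> path_mon \<alpha> v" if "\<alpha> \<in> T" for \<alpha>
    using T(2) that path_mon_vtx[of _ \<alpha> v v] awalk_last_in_verts by auto
  then show ?thesis
    unfolding T(3) sum_distrib_right by (intro lcong_sum) (simp add: lcong_scale flip: scale_mult_left)
qed

lemma path_mon_mult_edge:
  assumes "awalk u \<alpha> (tail E e)" "e \<in> arcs E"
  shows "path_mon \<alpha> (tail E e) * edge e \<approx> path_mon (\<alpha> @ [e]) (head E e)"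
proof -
  have "path_mon \<alpha> (tail E e) * edge e \<approx> path_mon \<alpha> (tail E e) * path_mon [e] (head E e)"
    using assms by (intro lcong_mult_left) (auto intro: path_mon_closed lcong_sym[OF edge_head])
  also have "\<dots> \<approx> path_mon (\<alpha> @ [e]) (head E e)"
    using assms by (intro path_mon_mult) (auto intro: arc_implies_awalk)
  finally show ?thesis .
qed

text \<open>
  Appending \<open>e\<close> is injective on paths, so the coefficients reappear unchanged; the map
  \<open>butlast\<close> recovers the old path from the new one.
\<close>

lemma path_sum_mult_edge:
  assumes e: "e \<in> arcs E" and T: "\<And>\<alpha>. \<alpha> \<in> T \<Longrightarrow> \<exists>u. awalk u \<alpha> (tail E e)"
  shows "(\<Sum>\<alpha>\<in>T. scale (c \<alpha>) (path_mon \<alpha> (tail E e))) * edge e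
    \<approx> (\<Sum>\<beta>\<in>(\<lambda>\<alpha>. \<alpha> @ [e]) ` T. scale (c (butlast \<beta>)) (path_mon \<beta> (head E e)))"
proof -
  have "(\<Sum>\<alpha>\<in>T. scale (c \<alpha>) (path_mon \<alpha> (tail E e))) * edge e
      \<approx> (\<Sum>\<alpha>\<in>T. scale (c \<alpha>) (path_mon (\<alpha> @ [e]) (head E e)))"
    unfolding sum_distrib_right using T e path_mon_mult_edge
    by (intro lcong_sum) (auto intro!: lcong_scale simp flip: scale_mult_left)
  also have "\<dots> = (\<Sum>\<beta>\<in>(\<lambda>\<alpha>. \<alpha> @ [e]) ` T. scale (c (butlast \<beta>)) (path_mon \<beta> (head E e)))"
    by (subst sum.reindex) (auto simp: inj_on_def)
  finally show ?thesis .
qed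

lemma awalk_snoc:
  assumes "e \<in> arcs E" "awalk u \<alpha> (tail E e)"
  shows "awalk u (\<alpha> @ [e]) (head E e)"
  using assms(2) arc_implies_awalk[OF assms(1)] by (rule awalk_appendI)

lemma path_form_mult_edge:
  assumes "path_form (tail E e) q" "e \<in> arcs E"
  shows "\<exists>r. path_form (head E e) r \<and> q * edge e \<approx> r"
proof -
  obtain T c where T: "finite T" "\<And>\<alpha>. \<alpha> \<in> T \<Longrightarrow> \<exists>u. awalk u \<alpha> (tail E e)"
    and q: "q = (\<Sum>\<alpha>\<in>T. scale (c \<alpha>) (path_mon \<alpha> (tail E e)))"
    using assms(1) unfolding path_form_def by blast
  have "\<exists>u. awalk u \<beta> (head E e)" if "\<beta> \<in> (\<lambda>\<alpha>. \<alpha> @ [e]) ` T" for \<beta>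
    using that T(2) awalk_snoc[OF assms(2)] by blast
  then have "path_form (head E e) (\<Sum>\<beta>\<in>(\<lambda>\<alpha>. \<alpha> @ [e]) ` T. scale (c (butlast \<beta>)) (path_mon \<beta> (head E e)))"
    unfolding path_form_def using T(1)
    by (intro exI[of _ "(\<lambda>\<alpha>. \<alpha> @ [e]) ` T"] exI[of _ "\<lambda>\<beta>. c (butlast \<beta>)"]) auto
  then show ?thesis
    using path_sum_mult_edge[OF assms(2) T(2)] q by blast
qed

lemma normal_at_cong: "normal_at d v x \<Longrightarrow> y \<approx> x \<Longrightarrow> normal_at d v y"
proof (cases d)
  case 0
  assume "normal_at d v x" "y \<approx> x"
  then show ?thesis
    unfolding 0 normal_at.simps by (blast intro: lcong_trans)
next
  case (Suc n)
  assume "normal_at d v x" "y \<approx> x"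
  then show ?thesis
    unfolding Suc normal_at.simps by (blast intro: lcong_trans)
qed

lemma normal_at_zero: "normal_at d v 0"
  by (cases d) (auto simp: normal_at_Suc_iff intro!: path_form_zero exI[of _ 0] exI[of _ "{}"])

lemma ghost_filtration_closed: "f \<in> ghost_filtration d \<Longrightarrow> f \<in> carrier (free_algebra E)"
  by (simp add: ghost_filtration_def)

lemma ghost_filtration_zero: "0 \<in> ghost_filtration d"
  by (simp add: ghost_filtration_def normal_at_zero free_algebra_closed)

lemma normal_at_add: "normal_at d v x \<Longrightarrow> normal_at d v y \<Longrightarrow> normal_at d v (x + y)"
proof (induction d arbitrary: v x y)
  case 0
  then show ?case
    using path_form_add lcong_add by (metis normal_at.simps(1))
next
  case (Suc d)
  obtain S a q where S: "finite S" "S \<subseteq> out_arcs E v" "\<forall>e\<in>S. a e \<in> ghost_filtration d"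
    "path_form v q" "x \<approx> (\<Sum>e\<in>S. a e * ghost e) + q"
    using Suc.prems(1) unfolding normal_at_Suc_iff by blast
  obtain T b r where T: "finite T" "T \<subseteq> out_arcs E v" "\<forall>e\<in>T. b e \<in> ghost_filtration d"
    "path_form v r" "y \<approx> (\<Sum>e\<in>T. b e * ghost e) + r"
    using Suc.prems(2) unfolding normal_at_Suc_iff by blast
  have add: "f + g \<in> ghost_filtration d"
    if "f \<in> ghost_filtration d" "g \<in> ghost_filtration d" for f g
    using that Suc.IH by (auto simp: ghost_filtration_def distrib_right intro: free_algebra_closed)
  define a' where "a' = (\<lambda>e. if e \<in> S then a e else 0)"
  define b' where "b' = (\<lambda>e. if e \<in> T then b e else 0)"
  have "(\<Sum>e\<in>S. a e * ghost e) = (\<Sum>e\<in>S \<union> T. a' e * ghost e)"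
    unfolding a'_def using S(1) T(1) by (intro sum.mono_neutral_cong_left) auto
  moreover have "(\<Sum>e\<in>T. b e * ghost e) = (\<Sum>e\<in>S \<union> T. b' e * ghost e)"
    unfolding b'_def using S(1) T(1) by (intro sum.mono_neutral_cong_left) auto
  ultimately have "x + y \<approx> (\<Sum>e\<in>S \<union> T. (a' e + b' e) * ghost e) + (q + r)"
    using lcong_add[OF S(5) T(5)] by (simp add: sum.distrib algebra_simps)
  moreover have "\<forall>e\<in>S \<union> T. a' e + b' e \<in> ghost_filtration d"
    using S(3) T(3) by (auto simp: a'_def b'_def intro!: add ghost_filtration_zero)
  ultimately show ?case
    unfolding normal_at_Suc_iff using S(1,2,4) T(1,2,4) path_form_add
    by (intro exI[of _ "S \<union> T"] exI[of _ "\<lambda>e. a' e + b' e"] exI[of _ "q + r"]) auto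
qed

lemma normal_at_scale: "normal_at d v x \<Longrightarrow> normal_at d v (scale c x)"
proof (induction d arbitrary: v x)
  case 0
  then show ?case
    using path_form_scale lcong_scale by (metis normal_at.simps(1))
next
  case (Suc d)
  obtain S a q where S: "finite S" "S \<subseteq> out_arcs E v" "\<forall>e\<in>S. a e \<in> ghost_filtration d"
    "path_form v q" "x \<approx> (\<Sum>e\<in>S. a e * ghost e) + q"
    using Suc.prems unfolding normal_at_Suc_iff by blast
  have "\<forall>e\<in>S. scale c (a e) \<in> ghost_filtration d"
    using S(3) Suc.IH by (auto simp: ghost_filtration_def free_algebra_closed simp flip: scale_mult_left)
  moreover have "scale c ((\<Sum>e\<in>S. a e * ghost e) + q) = (\<Sum>e\<in>S. scale c (a e) * ghost e) + scale c q"
    by (simp add: scale_def algebra_simps sum_distrib_left)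
  ultimately show ?case
    unfolding normal_at_Suc_iff using S path_form_scale lcong_scale[OF S(5), of c]
    by (intro exI[of _ S] exI[of _ "\<lambda>e. scale c (a e)"] exI[of _ "scale c q"]) auto
qed

lemma normal_at_Suc: "normal_at d v x \<Longrightarrow> normal_at (Suc d) v x"
proof (induction d arbitrary: v x)
  case 0
  then show ?case
    unfolding normal_at_Suc_iff by (auto intro!: exI[of _ "{}"])
next
  case (Suc d)
  then have "ghost_filtration d \<subseteq> ghost_filtration (Suc d)"
    by (auto simp: ghost_filtration_def)
  with Suc.prems show ?case
    unfolding normal_at_Suc_iff[of "Suc d"] normal_at_Suc_iff[of d] by blast
qed

lemma ghost_filtration_mono: "d \<le> d' \<Longrightarrow> ghost_filtration d \<subseteq> ghost_filtration d'"
  by (rule lift_Suc_mono_le) (auto simp: ghost_filtration_def normal_at_Suc)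

lemma ghost_filtration_add:
  "f \<in> ghost_filtration d \<Longrightarrow> g \<in> ghost_filtration d \<Longrightarrow> f + g \<in> ghost_filtration d"
  by (auto simp: ghost_filtration_def distrib_right intro: free_algebra_closed normal_at_add)

lemma ghost_filtration_scale: "f \<in> ghost_filtration d \<Longrightarrow> scale c f \<in> ghost_filtration d"
  by (auto simp: ghost_filtration_def free_algebra_closed normal_at_scale simp flip: scale_mult_left)

lemma ghost_filtration_cong:
  assumes "f \<in> ghost_filtration d" "g \<in> carrier (free_algebra E)" "g \<approx> f"
  shows "g \<in> ghost_filtration d"
proof -
  have "normal_at d v (g * vtx v)" if v: "v \<in> verts E" for v
  proof (rule normal_at_cong)
    show "normal_at d v (f * vtx v)"
      using assms(1) v by (simp add: ghost_filtration_def)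
    show "g * vtx v \<approx> f * vtx v"
      using v by (intro lcong_mult_right assms(3)) auto
  qed
  then show ?thesis
    using assms(2) by (simp add: ghost_filtration_def)
qed

text \<open>
  If \<open>x\<close> has range \<open>r\<close>, then \<open>f x v\<close> vanishes for every vertex \<open>v \<noteq> r\<close>, so a normal form has to
  be found at \<open>r\<close> only. The lemma is applied to vertices, edges and ghost edges in turn.
\<close>

lemma ghost_filtration_mult_gen:
  assumes f: "f \<in> carrier (free_algebra E)" and x: "x \<in> carrier (free_algebra E)" and r: "r \<in> verts E"
    and range: "\<And>v. v \<in> verts E \<Longrightarrow> x * vtx v \<approx> (if v = r then x else 0)"
    and normal: "normal_at d r (f * x)"
  shows "f * x \<in> ghost_filtration d"
proof -
  have "normal_at d v (f * x * vtx v)" if v: "v \<in> verts E" for v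
  proof -
    have "f * (x * vtx v) \<approx> f * (if v = r then x else 0)"
      using f by (intro lcong_mult_left range v)
    then have *: "f * x * vtx v \<approx> (if v = r then f * x else 0)"
      by (cases "v = r") (simp_all add: mult.assoc)
    have "normal_at d v (if v = r then f * x else 0)"
      using normal normal_at_zero by simp
    from normal_at_cong[OF this *] show ?thesis .
  qed
  then show ?thesis
    using f x by (simp add: ghost_filtration_def free_algebra_closed)
qed

lemma ghost_filtration_mult_vtx:
  assumes "f \<in> ghost_filtration d" "r \<in> verts E"
  shows "f * vtx r \<in> ghost_filtration d"
proof (rule ghost_filtration_mult_gen)
  show "vtx r * vtx v \<approx> (if v = r then vtx r else 0)" if "v \<in> verts E" for v
    using vtx_vtx[OF assms(2) that] by (cases "v = r") auto
qed (use assms in \<open>auto simp: ghost_filtration_def gen_closed\<close>)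

lemma ghost_filtration_mult_ghost:
  assumes "f \<in> ghost_filtration d" "e \<in> arcs E"
  shows "f * ghost e \<in> ghost_filtration (Suc d)"
proof (rule ghost_filtration_mult_gen)
  show "normal_at (Suc d) (tail E e) (f * ghost e)"
    unfolding normal_at_Suc_iff using assms path_form_zero
    by (intro exI[of _ "{e}"] exI[of _ "\<lambda>_. f"] exI[of _ 0]) auto
  show "ghost e * vtx v \<approx> (if v = tail E e then ghost e else 0)" if "v \<in> verts E" for v
    by (rule ghost_vtx[OF that assms(2)])
qed (use assms in \<open>auto intro: gen_closed ghost_filtration_closed\<close>)

lemma path_form_edge_ghost_filtration:
  assumes "path_form (tail E e) q" "e \<in> arcs E"
  shows "q * edge e \<in> ghost_filtration 0"
proof (rule ghost_filtration_mult_gen)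
  show "normal_at 0 (head E e) (q * edge e)"
    using path_form_mult_edge[OF assms] by simp
  show "edge e * vtx v \<approx> (if v = head E e then edge e else 0)" if "v \<in> verts E" for v
    by (rule edge_vtx[OF that assms(2)])
qed (use assms in \<open>auto intro: gen_closed path_form_closed\<close>)

lemma mult_edge_source:
  assumes "f \<in> carrier (free_algebra E)" "e \<in> arcs E" "f * vtx (tail E e) \<approx> y"
  shows "f * edge e \<approx> y * edge e"
proof -
  have "f * edge e \<approx> f * (vtx (tail E e) * edge e)"
    using assms by (intro lcong_mult_left lcong_sym[OF tail_edge])
  also have "\<dots> = f * vtx (tail E e) * edge e"
    by (simp add: mult.assoc)
  also have "\<dots> \<approx> y * edge e"
    using assms by (intro lcong_mult_right) auto
  finally show ?thesis .
qed

lemma normal_form_mult_edge: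
  assumes f: "f \<in> carrier (free_algebra E)" and e: "e \<in> arcs E"
    and S: "finite S" "S \<subseteq> arcs E" "\<And>g. g \<in> S \<Longrightarrow> a g \<in> carrier (free_algebra E)"
    and nf: "f * vtx (tail E e) \<approx> (\<Sum>g\<in>S. a g * ghost g) + q"
  shows "f * edge e \<approx> (if e \<in> S then a e * vtx (head E e) else 0) + q * edge e"
proof -
  have "(\<Sum>g\<in>S. a g * (ghost g * edge e)) \<approx> (\<Sum>g\<in>S. a g * (if g = e then vtx (head E g) else 0))"
    using S e by (intro lcong_sum lcong_mult_left ghost_edge) auto
  also have "\<dots> = (\<Sum>g\<in>S. if g = e then a g * vtx (head E g) else 0)"
    by (intro sum.cong) auto
  also have "\<dots> = (if e \<in> S then a e * vtx (head E e) else 0)"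
    using S(1) by (simp add: sum.delta)
  finally have sum: "(\<Sum>g\<in>S. a g * ghost g) * edge e \<approx> (if e \<in> S then a e * vtx (head E e) else 0)"
    by (simp add: sum_distrib_right mult.assoc)
  have "f * edge e \<approx> ((\<Sum>g\<in>S. a g * ghost g) + q) * edge e"
    by (rule mult_edge_source[OF f e nf])
  also have "\<dots> = (\<Sum>g\<in>S. a g * ghost g) * edge e + q * edge e"
    by (rule distrib_right)
  also have "\<dots> \<approx> (if e \<in> S then a e * vtx (head E e) else 0) + q * edge e"
    using sum by (rule lcong_add) simp
  finally show ?thesis .
qed

text \<open>
  The step that drives the induction: by \<open>g\<^sup>* e = \<delta>\<^sub>g\<^sub>e r(e)\<close>, right multiplication by an edge
  removes one ghost edge from every monomial that ends in one.
\<close>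

lemma ghost_filtration_mult_edge:
  assumes f: "f \<in> ghost_filtration (Suc d)" and e: "e \<in> arcs E"
  shows "f * edge e \<in> ghost_filtration d"
proof -
  have "normal_at (Suc d) (tail E e) (f * vtx (tail E e))"
    using f e by (auto simp: ghost_filtration_def)
  then obtain S a q where S: "finite S" "S \<subseteq> out_arcs E (tail E e)" "\<forall>e\<in>S. a e \<in> ghost_filtration d"
    and q: "path_form (tail E e) q" and nf: "f * vtx (tail E e) \<approx> (\<Sum>e\<in>S. a e * ghost e) + q"
    unfolding normal_at_Suc_iff by blast
  have "q * edge e \<in> ghost_filtration d"
    using path_form_edge_ghost_filtration[OF q e] ghost_filtration_mono[of 0 d] by auto
  then have "(if e \<in> S then a e * vtx (head E e) else 0) + q * edge e \<in> ghost_filtration d"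
    using S(3) e by (auto intro!: ghost_filtration_add ghost_filtration_mult_vtx ghost_filtration_zero)
  moreover have "f * edge e \<approx> (if e \<in> S then a e * vtx (head E e) else 0) + q * edge e"
    using f e S ghost_filtration_closed by (intro normal_form_mult_edge nf) auto
  ultimately show ?thesis
    using f e by (auto intro: ghost_filtration_cong free_algebra_closed gen_closed ghost_filtration_closed)
qed

lemma vtx_in_ghost_filtration: "u \<in> verts E \<Longrightarrow> vtx u \<in> ghost_filtration 0"
proof -
  assume u: "u \<in> verts E"
  have "normal_at 0 v (vtx u * vtx v)" if v: "v \<in> verts E" for v
  proof -
    have "path_form v (if u = v then vtx u else 0)"
      using path_form_vtx[OF v] path_form_zero by auto
    then show ?thesis
      using vtx_vtx[OF u v] by auto
  qed
  then show ?thesis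
    using u by (simp add: ghost_filtration_def gen_closed)
qed

text \<open>
  Monomials are built from the left, starting with the vertex at which the first generator
  begins. A vertex factor keeps the level, and a ghost edge raises it by one. For an edge factor,
  an element of level \<open>d\<close> is regarded as one of level \<open>d + 1\<close>, and the product has level \<open>d\<close>.
\<close>

lemma ghost_filtration_exhausts:
  fixes f :: "('v, 'e, 'k) ncpoly"
  assumes "f \<in> carrier (free_algebra E)"
  shows "\<exists>d. f \<in> ghost_filtration d"
proof -
  have mult_gen: "\<exists>d. g * Poly_Mapping.single (Word [x]) 1 \<in> ghost_filtration d"
    if g: "g \<in> ghost_filtration d" and x: "x \<in> generators E" for g d x
  proof -
    have "g \<in> ghost_filtration (Suc d)"
      using g ghost_filtration_mono[of d "Suc d"] by auto
    then show ?thesis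
      using x ghost_filtration_mult_vtx[OF g] ghost_filtration_mult_ghost[OF g]
        ghost_filtration_mult_edge[of g d]
      by (auto simp: generators_def simp flip: vtx_def edge_def ghost_def) blast+
  qed
  show ?thesis
    using assms
  proof (induction rule: free_algebra_induct)
    case zero
    then show ?case
      using ghost_filtration_zero by blast
  next
    case (add g h)
    then obtain m n where "g \<in> ghost_filtration m" "h \<in> ghost_filtration n"
      by blast
    then have "g \<in> ghost_filtration (max m n)" "h \<in> ghost_filtration (max m n)"
      using ghost_filtration_mono[of m "max m n"] ghost_filtration_mono[of n "max m n"] by auto
    then show ?case
      using ghost_filtration_add by blast
  next
    case (scale c g)
    then show ?case
      using ghost_filtration_scale by blast
  next
    case (gen x)
    have "\<exists>u\<in>verts E. vtx u * Poly_Mapping.single (Word [x]) 1 \<approx> Poly_Mapping.single (Word [x]) 1"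
      using gen vtx_vtx tail_edge head_ghost tail_in_verts head_in_verts
      by (fastforce simp: generators_def simp flip: vtx_def edge_def ghost_def)
    then obtain u where u: "u \<in> verts E"
      "vtx u * Poly_Mapping.single (Word [x]) 1 \<approx> Poly_Mapping.single (Word [x]) 1"
      by blast
    obtain d where "vtx u * Poly_Mapping.single (Word [x]) 1 \<in> ghost_filtration d"
      using mult_gen[OF vtx_in_ghost_filtration[OF u(1)] gen] by blast
    moreover have "Poly_Mapping.single (Word [x]) 1 \<in> carrier (free_algebra E)"
      using gen by (simp add: free_algebra_def)
    ultimately show ?case
      using ghost_filtration_cong lcong_sym[OF u(2)] by blast
  next
    case (mult g x)
    then show ?case
      using mult_gen by blast
  qed
qed

lemma generator_range:
  assumes "x \<in> generators E"
  shows "\<exists>r\<in>verts E. \<forall>v\<in>verts E.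
    Poly_Mapping.single (Word [x]) 1 * vtx v \<approx> (if v = r then Poly_Mapping.single (Word [x]) 1 else 0)"
  using assms unfolding generators_def
proof (elim UnE imageE)
  fix u assume u: "x = Vertex u" "u \<in> verts E"
  have "vtx u * vtx v \<approx> (if v = u then vtx u else 0)" if "v \<in> verts E" for v
    using vtx_vtx[OF u(2) that] by (cases "v = u") auto
  then show ?thesis
    using u unfolding u(1) vtx_def[symmetric] by blast
next
  fix e assume e: "x = Edge e" "e \<in> arcs E"
  then show ?thesis
    using edge_vtx[of _ e] head_in_verts[of e] unfolding e(1) edge_def[symmetric] by blast
next
  fix e assume e: "x = Ghost e" "e \<in> arcs E"
  then show ?thesis
    using ghost_vtx[of _ e] tail_in_verts[of e] unfolding e(1) ghost_def[symmetric] by blast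
qed

text \<open>
  Validity for all larger finite sets \<open>W\<close> makes the property additive: two elements are both
  fixed by the sum over the union of their sets of vertices.
\<close>

definition right_unit_above :: "'v set \<Rightarrow> ('v, 'e, 'k) ncpoly \<Rightarrow> bool" where
  "right_unit_above V f \<longleftrightarrow>
     (\<forall>W. finite W \<longrightarrow> V \<subseteq> W \<longrightarrow> W \<subseteq> verts E \<longrightarrow> (\<Sum>v\<in>W. f * vtx v) \<approx> f)"

lemma right_unit_generator:
  assumes "x \<in> generators E"
  shows "\<exists>r\<in>verts E. right_unit_above {r} (Poly_Mapping.single (Word [x]) 1)"
    (is "\<exists>r\<in>_. right_unit_above _ ?x")
proof -
  obtain r where r: "r \<in> verts E" "\<And>v. v \<in> verts E \<Longrightarrow> ?x * vtx v \<approx> (if v = r then ?x else 0)"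
    using generator_range[OF assms] by blast
  have "(\<Sum>v\<in>W. ?x * vtx v) \<approx> ?x" if W: "finite W" "{r} \<subseteq> W" "W \<subseteq> verts E" for W
  proof -
    have "(\<Sum>v\<in>W. ?x * vtx v) \<approx> (\<Sum>v\<in>W. if v = r then ?x else 0)"
      using W by (intro lcong_sum r) auto
    then show ?thesis
      using W by simp
  qed
  then show ?thesis
    using r(1) unfolding right_unit_above_def by blast
qed

lemma right_unit_exists:
  fixes f :: "('v, 'e, 'k) ncpoly"
  assumes "f \<in> carrier (free_algebra E)"
  shows "\<exists>V. finite V \<and> V \<subseteq> verts E \<and> right_unit_above V f"
  using assms
proof (induction rule: free_algebra_induct)
  case zero
  then show ?case
    by (intro exI[of _ "{}"]) (simp add: right_unit_above_def)
next
  case (add g h)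
  then obtain V V' where V: "finite V" "V \<subseteq> verts E" "right_unit_above V g"
    and V': "finite V'" "V' \<subseteq> verts E" "right_unit_above V' h"
    by blast
  have "right_unit_above (V \<union> V') (g + h)"
    using V(3) V'(3) by (auto simp: right_unit_above_def distrib_right sum.distrib intro!: lcong_add)
  then show ?case
    using V V' by blast
next
  case (scale c g)
  then obtain V where V: "finite V" "V \<subseteq> verts E" "right_unit_above V g"
    by blast
  have "right_unit_above V (scale c g)"
    using V(3) unfolding right_unit_above_def scale_mult_left[symmetric] scale_sum[symmetric]
    by (blast intro: lcong_scale)
  then show ?case
    using V by blast
next
  case (gen x)
  then obtain r where "r \<in> verts E" "right_unit_above {r} (Poly_Mapping.single (Word [x]) 1)"
    using right_unit_generator by blast
  then show ?case
    by (intro exI[of _ "{r}"]) simp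
next
  case (mult g x)
  then obtain r where r: "r \<in> verts E" "right_unit_above {r} (Poly_Mapping.single (Word [x]) 1)"
    using right_unit_generator by blast
  have "right_unit_above {r} (g * Poly_Mapping.single (Word [x]) 1)"
    using r(2) mult(1) unfolding right_unit_above_def mult.assoc sum_distrib_left[symmetric]
    by (blast intro: lcong_mult_left)
  then show ?case
    using r(1) by (intro exI[of _ "{r}"]) simp
qed

lemma zero_if_zero_at_vertices:
  assumes "f \<in> carrier (free_algebra E)" "\<And>v. v \<in> verts E \<Longrightarrow> f * vtx v \<approx> 0"
  shows "f \<approx> 0"
proof -
  obtain V where V: "finite V" "V \<subseteq> verts E" "(\<Sum>v\<in>V. f * vtx v) \<approx> f"
    using right_unit_exists[OF assms(1)] unfolding right_unit_above_def by blast
  have "f \<approx> (\<Sum>v\<in>V. f * vtx v)"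
    using V(3) by (rule lcong_sym)
  also have "\<dots> \<approx> (\<Sum>v\<in>V. 0)"
    using V assms(2) by (intro lcong_sum) auto
  finally show ?thesis
    by simp
qed

end

section \<open>Ideals that contain no vertex\<close>

locale vertex_free_ideal = leavitt_graph E "TYPE('k)"
  for E :: "('v, 'e) pre_digraph" and J :: "('v, 'e, 'k::field) ncpoly set" +
  assumes J_closed: "x \<in> J \<Longrightarrow> x \<in> carrier (free_algebra E)"
    and relations: "x \<in> leavitt_ideal E \<Longrightarrow> x \<in> J"
    and J_add: "x \<in> J \<Longrightarrow> y \<in> J \<Longrightarrow> x + y \<in> J"
    and J_mult_left: "a \<in> carrier (free_algebra E) \<Longrightarrow> x \<in> J \<Longrightarrow> a * x \<in> J"
    and J_mult_right: "x \<in> J \<Longrightarrow> a \<in> carrier (free_algebra E) \<Longrightarrow> x * a \<in> J"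
    and vtx_notin: "v \<in> verts E \<Longrightarrow> vtx v \<notin> J"
    and L: "condition_L E"
begin

lemma lcong_J: "x \<in> J \<Longrightarrow> x \<approx> y \<Longrightarrow> y \<in> J"
  using J_add[of x "y - x"] relations[of "y - x"] by (simp add: lcong_def lcong_sym[unfolded lcong_def])

lemma scale_vtx_notin:
  assumes "v \<in> verts E" "c \<noteq> 0"
  shows "scale c (vtx v) \<notin> J"
proof
  assume "scale c (vtx v) \<in> J"
  then have "scale (1 / c) (vtx v) * scale c (vtx v) \<in> J"
    using assms by (intro J_mult_left free_algebra_closed gen_closed)
  then have "vtx v * vtx v \<in> J"
    using assms by (simp add: scale_mult_right scale_scale flip: scale_mult_left)
  then show False
    using lcong_J vtx_vtx[of v v] vtx_notin assms by auto
qed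

text \<open>
  Each compression by a path \<open>\<tau>\<close> that leaves the first loop kills that loop and creates no new one,
  so the number of loops decreases until only a multiple of a vertex is left.
\<close>

lemma vertex_plus_loops_notin:
  assumes "v \<in> verts E" "k \<noteq> 0" "loops_at v xs"
  shows "scale k (vtx v) + loop_sum xs v \<notin> J"
  using assms(1,3)
proof (induction "length xs" arbitrary: v xs rule: less_induct)
  case less
  show ?case
  proof (cases xs)
    case Nil
    then show ?thesis
      using scale_vtx_notin less.prems assms by simp
  next
    case (Cons x zs)
    then obtain c \<gamma> where xs: "xs = (c, \<gamma>) # zs"
      by (cases x) auto
    with less.prems have \<gamma>: "awalk v \<gamma> v" "\<gamma> \<noteq> []" and zs: "loops_at v zs"
      by auto
    from exit_path[OF L \<gamma>] obtain \<tau> w where \<tau>: "awalk v \<tau> w" "length \<tau> \<le> length \<gamma>"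
      "take (length \<tau>) \<gamma> \<noteq> \<tau>"
      by blast
    let ?c = "\<lambda>x :: ('v, 'e, 'k) ncpoly. ghost_mon \<tau> w * x * path_mon \<tau> w"
    have "?c (path_mon \<gamma> v) \<approx> 0"
    proof -
      \<comment> \<open>\<open>\<tau>\<close> is no longer than \<open>\<gamma>\<close> and no prefix of it, so it is no prefix of \<open>\<gamma> \<tau>\<close>.\<close>
      have "\<gamma> @ \<tau> \<noteq> \<tau> @ \<gamma>'" for \<gamma>'
      proof
        assume "\<gamma> @ \<tau> = \<tau> @ \<gamma>'"
        then have "take (length \<tau>) (\<gamma> @ \<tau>) = \<tau>"
          by simp
        then show False
          using \<tau>(2,3) by simp
      qed
      then show ?thesis
        using compress_loop[OF \<gamma> \<tau>(1)] by blast
    qed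
    then have loop: "scale c (?c (path_mon \<gamma> v)) \<approx> 0"
      using lcong_scale by fastforce
    obtain ys where ys: "length ys \<le> length zs" "loops_at w ys" "?c (loop_sum zs v) \<approx> loop_sum ys w"
      using compress_loop_sum[OF zs \<tau>(1)] by blast
    have "ghost_mon \<tau> w * (vtx v * path_mon \<tau> w) \<approx> ghost_mon \<tau> w * path_mon \<tau> w"
      using vtx_path_mon[OF \<tau>(1), of v] less.prems \<tau>(1)
      by (intro lcong_mult_left) (auto intro: ghost_mon_closed)
    also have "\<dots> \<approx> vtx w"
      by (rule ghost_path_cancel[OF \<tau>(1)])
    finally have vtx: "?c (vtx v) \<approx> vtx w"
      by (simp add: mult.assoc)
    have "?c (scale k (vtx v) + loop_sum xs v)
        = scale k (?c (vtx v)) + (scale c (?c (path_mon \<gamma> v)) + ?c (loop_sum zs v))"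
      by (simp add: xs algebra_simps scale_mult_right flip: scale_mult_left)
    also have "\<dots> \<approx> scale k (vtx w) + (0 + loop_sum ys w)"
      by (intro lcong_add lcong_scale vtx loop ys)
    finally have "?c (scale k (vtx v) + loop_sum xs v) \<approx> scale k (vtx w) + loop_sum ys w"
      by simp
    moreover have "scale k (vtx w) + loop_sum ys w \<notin> J"
      using less.hyps[of ys w] ys \<tau>(1) xs by auto
    ultimately show ?thesis
      using \<tau>(1) lcong_J J_mult_left J_mult_right ghost_mon_closed path_mon_closed by metis
  qed
qed

text \<open>
  Paths with common range are linearly independent modulo \<open>J\<close>. If \<open>\<alpha>\<close> is a shortest path with
  nonzero coefficient, then \<open>\<alpha>\<^sup>*\<close> sends \<open>\<alpha>\<close> to the vertex \<open>v\<close> and every other path \<open>\<beta>\<close> to zero or,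
  if \<open>\<beta> = \<alpha> \<gamma>\<close>, to \<open>\<gamma>\<close>. Since \<open>\<alpha>\<close> and \<open>\<beta>\<close> both end at \<open>v\<close>, this \<open>\<gamma>\<close> is a closed path at \<open>v\<close>, of
  positive length because \<open>\<beta> \<noteq> \<alpha>\<close>.
\<close>

lemma path_sum_in_J:
  assumes fin: "finite T" and walks: "\<And>\<alpha>. \<alpha> \<in> T \<Longrightarrow> \<exists>u. awalk u \<alpha> v"
    and J: "(\<Sum>\<alpha>\<in>T. scale (c \<alpha>) (path_mon \<alpha> v)) \<in> J"
  shows "\<forall>\<alpha>\<in>T. c \<alpha> = 0"
proof (rule ccontr)
  define T' where "T' = {\<alpha> \<in> T. c \<alpha> \<noteq> 0}"
  assume "\<not> (\<forall>\<alpha>\<in>T. c \<alpha> = 0)"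
  then have "\<exists>\<alpha>. \<alpha> \<in> T'"
    by (auto simp: T'_def)
  then obtain \<alpha> where \<alpha>: "\<alpha> \<in> T'" and min: "\<And>\<beta>. \<beta> \<in> T' \<Longrightarrow> length \<alpha> \<le> length \<beta>"
    using ex_has_least_nat[of "\<lambda>\<alpha>. \<alpha> \<in> T'" _ length] by blast
  obtain u where u: "awalk u \<alpha> v"
    using \<alpha> walks by (auto simp: T'_def)
  let ?g = "ghost_mon \<alpha> v :: ('v, 'e, 'k) ncpoly"
  have loops: "\<exists>xs. loops_at v xs \<and> ?g * (\<Sum>\<beta>\<in>B. scale (c \<beta>) (path_mon \<beta> v)) \<approx> loop_sum xs v"
    if "finite B" "B \<subseteq> T' - {\<alpha>}" for B
    using that
  proof (induction B rule: finite_induct)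
    case empty
    then show ?case
      by (intro exI[of _ "[]"]) simp
  next
    case (insert \<beta> B)
    then obtain xs where xs: "loops_at v xs" "?g * (\<Sum>\<beta>\<in>B. scale (c \<beta>) (path_mon \<beta> v)) \<approx> loop_sum xs v"
      by auto
    have split: "?g * (\<Sum>\<beta>\<in>insert \<beta> B. scale (c \<beta>) (path_mon \<beta> v))
        = scale (c \<beta>) (?g * path_mon \<beta> v) + ?g * (\<Sum>\<beta>\<in>B. scale (c \<beta>) (path_mon \<beta> v))"
      using insert.hyps by (simp add: algebra_simps scale_mult_right)
    obtain u' where u': "awalk u' \<beta> v"
      using insert.prems walks by (auto simp: T'_def)
    have "length \<alpha> \<le> length \<beta>"
      using min insert.prems by blast
    from ghost_path_mult[OF u u' this] show ?case
    proof (elim disjE exE conjE)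
      fix \<gamma>
      assume \<gamma>: "\<beta> = \<alpha> @ \<gamma>" "awalk v \<gamma> v" "?g * path_mon \<beta> v \<approx> path_mon \<gamma> v"
      then have "loops_at v ((c \<beta>, \<gamma>) # xs)"
        using xs insert.prems by auto
      moreover have "?g * (\<Sum>\<beta>\<in>insert \<beta> B. scale (c \<beta>) (path_mon \<beta> v)) \<approx> loop_sum ((c \<beta>, \<gamma>) # xs) v"
        unfolding split loop_sum_simps by (intro lcong_add lcong_scale \<gamma>(3) xs)
      ultimately show ?thesis
        by blast
    next
      assume *: "?g * path_mon \<beta> v \<approx> 0"
      have "?g * (\<Sum>\<beta>\<in>insert \<beta> B. scale (c \<beta>) (path_mon \<beta> v)) \<approx> scale (c \<beta>) 0 + loop_sum xs v"
        unfolding split by (intro lcong_add lcong_scale * xs)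
      then show ?thesis
        using xs by auto
    qed
  qed
  have fin': "finite T'"
    using fin by (simp add: T'_def)
  then obtain xs where xs: "loops_at v xs"
    "?g * (\<Sum>\<beta>\<in>T' - {\<alpha>}. scale (c \<beta>) (path_mon \<beta> v)) \<approx> loop_sum xs v"
    using loops[of "T' - {\<alpha>}"] by auto
  have "(\<Sum>\<alpha>\<in>T. scale (c \<alpha>) (path_mon \<alpha> v)) = (\<Sum>\<alpha>\<in>T'. scale (c \<alpha>) (path_mon \<alpha> v))"
    unfolding T'_def using fin by (intro sum.mono_neutral_right) auto
  also have "\<dots> = scale (c \<alpha>) (path_mon \<alpha> v) + (\<Sum>\<beta>\<in>T' - {\<alpha>}. scale (c \<beta>) (path_mon \<beta> v))"
    using fin' \<alpha> by (simp add: sum.remove)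
  finally have "?g * (\<Sum>\<alpha>\<in>T. scale (c \<alpha>) (path_mon \<alpha> v))
      = scale (c \<alpha>) (?g * path_mon \<alpha> v) + ?g * (\<Sum>\<beta>\<in>T' - {\<alpha>}. scale (c \<beta>) (path_mon \<beta> v))"
    by (simp add: algebra_simps scale_mult_right)
  also have "\<dots> \<approx> scale (c \<alpha>) (vtx v) + loop_sum xs v"
    by (intro lcong_add lcong_scale ghost_path_cancel[OF u] xs)
  finally have "scale (c \<alpha>) (vtx v) + loop_sum xs v \<in> J"
    using J_mult_left[OF ghost_mon_closed[OF u] J] lcong_J by blast
  then show False
    using vertex_plus_loops_notin[of v "c \<alpha>" xs] \<alpha> xs u by (auto simp: T'_def)
qed

lemma path_form_in_J:
  assumes "path_form v q" "q \<in> J"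
  shows "q = 0"
proof -
  obtain T c where T: "finite T" "\<And>\<alpha>. \<alpha> \<in> T \<Longrightarrow> \<exists>u. awalk u \<alpha> v"
    and q: "q = (\<Sum>\<alpha>\<in>T. scale (c \<alpha>) (path_mon \<alpha> v))"
    using assms(1) unfolding path_form_def by blast
  then show ?thesis
    using path_sum_in_J[OF T, of c] assms(2) by simp
qed

text \<open>
  Multiplication by \<open>e\<close> turns distinct paths into distinct paths with the same coefficients, so
  linear independence applies to \<open>q e\<close>.
\<close>

lemma path_form_mult_edge_in_J:
  assumes e: "e \<in> arcs E" and q: "path_form (tail E e) q" and J: "q * edge e \<in> J"
  shows "q = 0"
proof -
  obtain T c where T: "finite T" "\<And>\<alpha>. \<alpha> \<in> T \<Longrightarrow> \<exists>u. awalk u \<alpha> (tail E e)"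
    and q: "q = (\<Sum>\<alpha>\<in>T. scale (c \<alpha>) (path_mon \<alpha> (tail E e)))"
    using q unfolding path_form_def by blast
  have "\<forall>\<beta>\<in>(\<lambda>\<alpha>. \<alpha> @ [e]) ` T. c (butlast \<beta>) = 0"
  proof (rule path_sum_in_J)
    show "\<exists>u. awalk u \<beta> (head E e)" if "\<beta> \<in> (\<lambda>\<alpha>. \<alpha> @ [e]) ` T" for \<beta>
      using that T(2) awalk_snoc[OF e] by blast
    show "(\<Sum>\<beta>\<in>(\<lambda>\<alpha>. \<alpha> @ [e]) ` T. scale (c (butlast \<beta>)) (path_mon \<beta> (head E e))) \<in> J"
      using lcong_J[OF J] path_sum_mult_edge[OF e T(2)] q by simp
  qed (use T in simp)
  then show ?thesis
    using q by simp
qed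

text \<open>
  Induction on the number of ghost edges. Since \<open>f e\<close> needs one ghost edge less than \<open>f\<close>, it is
  zero for every edge \<open>e\<close> leaving \<open>v\<close>; this determines all the ghost terms of \<open>f v\<close> from its path
  part \<open>q\<close> and leaves \<open>f v = q (v - (\<Sum>e\<in>S. e e\<^sup>*))\<close>.
\<close>

lemma ghost_filtration_in_J_zero:
  "f \<in> J \<Longrightarrow> f \<in> ghost_filtration d \<Longrightarrow> f \<approx> 0"
proof (induction d arbitrary: f)
  case 0
  show ?case
  proof (rule zero_if_zero_at_vertices[OF J_closed[OF 0(1)]])
    fix v assume v: "v \<in> verts E"
    then obtain q where q: "path_form v q" "f * vtx v \<approx> q"
      using 0(2) by (auto simp: ghost_filtration_def)
    moreover have "f * vtx v \<in> J"
      using v 0(1) by (intro J_mult_right gen_closed)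
    ultimately show "f * vtx v \<approx> 0"
      using path_form_in_J lcong_J by metis
  qed
next
  case (Suc d)
  note f = J_closed[OF Suc.prems(1)]
  show ?case
  proof (rule zero_if_zero_at_vertices[OF f])
    fix v assume v: "v \<in> verts E"
    then obtain S a q where S: "finite S" "S \<subseteq> out_arcs E v" "\<forall>e\<in>S. a e \<in> ghost_filtration d"
      and q: "path_form v q" and nf: "f * vtx v \<approx> (\<Sum>e\<in>S. a e * ghost e) + q"
      using Suc.prems(2) unfolding ghost_filtration_def normal_at_Suc_iff by blast
    have edge_zero: "f * edge e \<approx> 0" if "e \<in> out_arcs E v" for e
      using that Suc.prems
      by (intro Suc.IH J_mult_right ghost_filtration_mult_edge gen_closed) auto
    have edge: "f * edge e \<approx> (if e \<in> S then a e * vtx (head E e) else 0) + q * edge e"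
      if "e \<in> out_arcs E v" for e
      using that S nf ghost_filtration_closed
      by (intro normal_form_mult_edge[OF f]) auto
    have a: "a e * ghost e \<approx> - (q * (edge e * ghost e))" if e: "e \<in> S" for e
    proof -
      have e': "e \<in> out_arcs E v" "e \<in> arcs E"
        using e S(2) by auto
      have "a e * vtx (head E e) + q * edge e \<approx> 0"
        using lcong_trans[OF lcong_sym[OF edge[OF e'(1)]] edge_zero[OF e'(1)]] e by simp
      then have "a e * vtx (head E e) \<approx> - (q * edge e)"
        by (simp add: lcong_def)
      then have "a e * vtx (head E e) * ghost e \<approx> - (q * edge e) * ghost e"
        using e' by (intro lcong_mult_right) auto
      then have "a e * (vtx (head E e) * ghost e) \<approx> - (q * (edge e * ghost e))"
        by (simp add: mult.assoc)
      moreover have "a e * ghost e \<approx> a e * (vtx (head E e) * ghost e)"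
        using e e' S(3) ghost_filtration_closed
        by (intro lcong_mult_left lcong_sym[OF head_ghost]) auto
      ultimately show ?thesis
        by (blast intro: lcong_trans)
    qed
    have "f * vtx v \<approx> (\<Sum>e\<in>S. - (q * (edge e * ghost e))) + q"
      using a by (intro lcong_trans[OF nf] lcong_add lcong_sum) auto
    then have fv: "f * vtx v \<approx> q - q * (\<Sum>e\<in>S. edge e * ghost e)"
      by (simp add: sum_negf sum_distrib_left)
    \<comment> \<open>Either the relation at the regular vertex \<open>v\<close> applies, or the path part \<open>q\<close> is zero.\<close>
    show "f * vtx v \<approx> 0"
    proof (cases "S = out_arcs E v \<and> S \<noteq> {}")
      case True
      then have "regular_vertex E v"
        using v S(1) by (auto simp: regular_vertex_def)
      then have "q * vtx v \<approx> q * (\<Sum>e\<in>S. edge e * ghost e)"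
        using regular_vtx True path_form_closed[OF q]
        by (intro lcong_mult_left) auto
      then have "q - q * (\<Sum>e\<in>S. edge e * ghost e) \<approx> q * vtx v - q * vtx v"
        by (intro lcong_diff lcong_sym[OF path_form_mult_vtx[OF q]]) (rule lcong_sym)
      then show ?thesis
        using lcong_trans[OF fv] by simp
    next
      case False
      have "q = 0"
      proof (cases "out_arcs E v = {}")
        case True
        then have "f * vtx v \<approx> q"
          using fv S(2) by simp
        moreover have "f * vtx v \<in> J"
          using v Suc.prems(1) by (intro J_mult_right gen_closed)
        ultimately show ?thesis
          using path_form_in_J[OF q] lcong_J by blast
      next
        case nonempty: False
        then obtain g where g: "g \<in> out_arcs E v" "g \<notin> S"
          using False S(2) by blast
        have "q * edge g \<approx> 0"
          using lcong_trans[OF lcong_sym[OF edge[OF g(1)]] edge_zero[OF g(1)]] g(2) by simp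
        then have "q * edge g \<in> J"
          using relations by (simp add: lcong_zero_iff)
        then show ?thesis
          using path_form_mult_edge_in_J[of g q] g(1) q by auto
      qed
      then show ?thesis
        using fv by simp
    qed
  qed
qed

text \<open>
  The uniqueness theorem for ideals: under Condition (L), an ideal that properly contains the
  ideal of Leavitt relations contains a vertex.
\<close>

theorem vertex_free_ideal_trivial: "J = leavitt_ideal E"
  using ghost_filtration_in_J_zero ghost_filtration_exhausts J_closed relations lcong_zero_iff by blast

end

section \<open>The uniqueness theorem\<close>

context nonunital_ring
begin

lemma l_null: "x \<in> carrier R \<Longrightarrow> \<zero> \<otimes> x = \<zero>"
  using l_distr[of \<zero> \<zero> x] m_closed[of \<zero> x] by simp

lemma r_null: "x \<in> carrier R \<Longrightarrow> x \<otimes> \<zero> = \<zero>"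
  using r_distr[of \<zero> \<zero> x] m_closed[of x \<zero>] by simp

end

lemma nonunital_ring_hom_zero:
  assumes "nonunital_ring R" "nonunital_ring S" "h \<in> nonunital_ring_hom R S"
  shows "h \<zero>\<^bsub>R\<^esub> = \<zero>\<^bsub>S\<^esub>"
proof -
  interpret R: nonunital_ring R by fact
  interpret S: nonunital_ring S by fact
  have "h \<zero>\<^bsub>R\<^esub> \<oplus>\<^bsub>S\<^esub> h \<zero>\<^bsub>R\<^esub> = h \<zero>\<^bsub>R\<^esub>" "h \<zero>\<^bsub>R\<^esub> \<in> carrier S"
    using assms(3) R.zero_closed R.l_zero[OF R.zero_closed]
    unfolding nonunital_ring_hom_def by (force, blast)
  then show ?thesis
    using S.add.l_cancel_one' by metis
qed

theorem theorem6p8: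
  fixes E :: "('v, 'e) pre_digraph"
    and A :: "('a, 'm) ring_scheme"
    and \<pi> :: "('v, 'e, 'k::field) ncpoly set \<Rightarrow> 'a"
  assumes "wf_digraph E" and "countable (verts E)" and "countable (arcs E)"
    and "condition_L E"
    and "nonunital_ring A"
    and "\<pi> \<in> nonunital_ring_hom (leavitt_path_algebra E) A"
    and "\<forall>v\<in>verts E. \<pi> (lpa_vertex E v) \<noteq> \<zero>\<^bsub>A\<^esub>"
  shows "inj_on \<pi> (carrier (leavitt_path_algebra E))"
proof -
  let ?F = "carrier (free_algebra E) :: ('v, 'e, 'k) ncpoly set"
  let ?q = "\<lambda>f :: ('v, 'e, 'k) ncpoly. leavitt_ideal E +>\<^bsub>free_algebra E\<^esub> f"
  interpret A: nonunital_ring A by fact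
  note E = \<open>wf_digraph E\<close>
  have coset: "?q f \<in> carrier (leavitt_path_algebra E)" if "f \<in> ?F" for f
    using that by (simp add: leavitt_path_algebra_carrier[OF E])
  have closed: "\<pi> (?q f) \<in> carrier A" if "f \<in> ?F" for f
    using coset[OF that] assms(6) by (auto simp: nonunital_ring_hom_def)
  have add: "\<pi> (?q (f + g)) = \<pi> (?q f) \<oplus>\<^bsub>A\<^esub> \<pi> (?q g)" if "f \<in> ?F" "g \<in> ?F" for f g
    using assms(6) coset that
    by (simp add: nonunital_ring_hom_def leavitt_path_algebra_simps(3) flip: leavitt_coset_add[OF E])
  have mult: "\<pi> (?q (f * g)) = \<pi> (?q f) \<otimes>\<^bsub>A\<^esub> \<pi> (?q g)" if "f \<in> ?F" "g \<in> ?F" for f g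
    using assms(6) coset that
    by (simp add: nonunital_ring_hom_def leavitt_path_algebra_simps(2) flip: leavitt_coset_mult[OF E])
  have zero: "\<pi> (?q 0) = \<zero>\<^bsub>A\<^esub>"
    using nonunital_ring_hom_zero[OF leavitt_path_algebra_nonunital_ring[OF E] assms(5,6)]
    by (simp add: leavitt_path_algebra_simps(4) leavitt_ideal_coset[OF E])
  interpret J: vertex_free_ideal E "{f \<in> ?F. \<pi> (?q f) = \<zero>\<^bsub>A\<^esub>}"
  proof (intro vertex_free_ideal.intro leavitt_graph.intro E vertex_free_ideal_axioms.intro)
    fix x :: "('v, 'e, 'k) ncpoly"
    assume x: "x \<in> leavitt_ideal E"
    then have "?q x = ?q 0"
      by (simp add: leavitt_ideal_coset_eq_iff[OF E])
    then show "x \<in> {f \<in> ?F. \<pi> (?q f) = \<zero>\<^bsub>A\<^esub>}"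
      using zero x leavitt_ideal_closed[OF E] by simp
  next
    show "vtx v \<notin> {f \<in> ?F. \<pi> (?q f) = \<zero>\<^bsub>A\<^esub>}" if "v \<in> verts E" for v
      using assms(7) that by (simp add: lpa_vertex_def)
  qed (use assms(4) in \<open>auto simp: add mult closed A.l_null A.r_null free_algebra_closed\<close>)
  show ?thesis
  proof (rule inj_onI)
    fix X Y
    assume "X \<in> carrier (leavitt_path_algebra E)" "Y \<in> carrier (leavitt_path_algebra E)" "\<pi> X = \<pi> Y"
    then obtain f g where f: "f \<in> ?F" "X = ?q f" and g: "g \<in> ?F" "Y = ?q g"
      by (auto simp: leavitt_path_algebra_carrier[OF E])
    have "\<pi> (?q (f - g)) \<oplus>\<^bsub>A\<^esub> \<pi> (?q g) = \<pi> (?q f)"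
      using add[OF free_algebra_closed(4)[OF f(1) g(1)] g(1)] f(2) by simp
    then have "\<pi> (?q (f - g)) \<oplus>\<^bsub>A\<^esub> \<pi> (?q g) = \<pi> (?q g)"
      using \<open>\<pi> X = \<pi> Y\<close> f g by simp
    then have "\<pi> (?q (f - g)) = \<zero>\<^bsub>A\<^esub>"
      using closed[OF free_algebra_closed(4)[OF f(1) g(1)]] closed[OF g(1)] by simp
    then have "f - g \<in> leavitt_ideal E"
      using J.vertex_free_ideal_trivial f g free_algebra_closed(4) by blast
    then show "X = Y"
      using f g leavitt_ideal_coset_eq_iff[OF E] by blast
  qed
qed

end
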